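(* For every integer $d$ and every non-trivial finite Abelian group $G$ there exist a positive constant $\delta$ and a family $(\mathbb{A}_n)_{n\ge1}$ of unsatisfiable instances of $3\mathrm{LIN}(G)$, where $\mathbb{A}_n$ has $\Theta(n)$ variables and $\Theta(n)$ equations, such that for every sufficiently large $n$ every Frege refutation of $\mathrm{CNF}(\mathbb{A}_n,\mathbb{B}(G,3))$ of depth $d$ has size at least $2^{n^{\delta}}$.
   Context: For a finite Abelian group $G$, $\mathbb{B}(G,3)$ is the relational structure with domain $G$ having, for each distinct relation of the form $\{(g_1,g_2,g_3)\in G^3: z_1g_1+z_2g_2+z_3g_3=g\}$ with $g\in G$, $(z_1,z_2,z_3)\in\mathbb{Z}^3$, one ternary relation symbol interpreted as this relation. $3\mathrm{LIN}(G)$ is $\mathrm{CSP}(\mathbb{B}(G,3))$: an instance is a finite structure $\mathbb{A}$ in this vocabulary, i.e. a system of linear equations over $G$ with three variable positions per equation (variables = elements of $A$); it is unsatisfiable if no homomorphism to $\mathbb{B}(G,3)$ exists. $\mathrm{CNF}(\mathbb{A},\mathbb{B})$ is the set of clauses over variables $X(a,b)$: $\bigvee_{b\in B}X(a,b)$ for $a\in A$; $\overline{X(a,b_0)}\vee\overline{X(a,b_1)}$ for $a\in A$, $b_0\ne b_1$; $\bigvee_{i=1}^r\overline{X(a_i,b_i)}$ for each relation symbol $R$ of arity $r$, $(a_1,\dots,a_r)\in R(\mathbb{A})$, $(b_1,\dots,b_r)\in B^r\setminus R(\mathbb{B})$. Frege (Tait-style, negation normal form): axiom $A\vee\overline A$;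 cut $C\vee A, D\vee\overline A\vdash C\vee D$; $C\vee A,D\vee B\vdash C\vee D\vee(A\wedge B)$; weakening $C\vdash C\vee D$; a refutation derives the empty formula; size = total size of its formulas. $\Sigma_{1,k}$ = $k$-DNFs, $\Pi_{1,k}$ = $k$-CNFs, $\Sigma_{t,k}$ = disjunctions of $\Pi_{t-1,k}$-formulas, $\Pi_{t,k}$ = conjunctions of $\Sigma_{t-1,k}$-formulas; a Frege refutation of depth $d$ is one all of whose formulas lie in $\Sigma_{d,1}$. *)

theory Defs
  imports Complex_Main "HOL-Algebra.Group" "HOL-Library.Landau_Symbols"
begin

section \<open>Relational structures\<close>

record 'r vocabulary =
  symbols :: "'r set"
  arity :: "'r \<Rightarrow> nat"

record ('r, 'a) rel_struct =
  universe :: "'a set"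
  interp :: "'r \<Rightarrow> 'a list set"

definition tuples :: "nat \<Rightarrow> 'a set \<Rightarrow> 'a list set" where
  "tuples r A = {as. length as = r \<and> set as \<subseteq> A}"

definition is_struct :: "'r vocabulary \<Rightarrow> ('r, 'a) rel_struct \<Rightarrow> bool" where
  "is_struct V S \<longleftrightarrow>
     (\<forall>R \<in> symbols V. interp S R \<subseteq> tuples (arity V R) (universe S))"

definition homomorphism ::
  "'r vocabulary \<Rightarrow> ('r, 'a) rel_struct \<Rightarrow> ('r, 'b) rel_struct \<Rightarrow> ('a \<Rightarrow> 'b) \<Rightarrow> bool" where
  "homomorphism V S T h \<longleftrightarrow>
     h ` universe S \<subseteq> universe T \<and>
     (\<forall>R \<in> symbols V. \<forall>as \<in> interp S R. map h as \<in> interp T R)"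

definition csp_instance :: "'r vocabulary \<Rightarrow> ('r, 'a) rel_struct \<Rightarrow> bool" where
  "csp_instance V S \<longleftrightarrow> is_struct V S \<and> finite (universe S)"

definition unsatisfiable ::
  "'r vocabulary \<Rightarrow> ('r, 'a) rel_struct \<Rightarrow> ('r, 'b) rel_struct \<Rightarrow> bool" where
  "unsatisfiable V S T \<longleftrightarrow> \<not> (\<exists>h. homomorphism V S T h)"

definition num_variables :: "('r, 'a) rel_struct \<Rightarrow> nat" where
  "num_variables S = card (universe S)"

definition num_constraints :: "'r vocabulary \<Rightarrow> ('r, 'a) rel_struct \<Rightarrow> nat" where
  "num_constraints V S = card {(R, as). R \<in> symbols V \<and> as \<in> interp S R}"


section \<open>Linear equations over a finite Abelian group\<close>

text \<open>Groups are written multiplicatively in HOL-Algebra: the equation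
  $z_1 g_1 + z_2 g_2 + z_3 g_3 = g$ becomes a product of integer powers.\<close>

definition lin_rel ::
  "('g, 'm) monoid_scheme \<Rightarrow> int \<Rightarrow> int \<Rightarrow> int \<Rightarrow> 'g \<Rightarrow> 'g list set" where
  "lin_rel G z1 z2 z3 g =
     {[g1, g2, g3] | g1 g2 g3. g1 \<in> carrier G \<and> g2 \<in> carrier G \<and> g3 \<in> carrier G \<and>
        g1 [^]\<^bsub>G\<^esub> z1 \<otimes>\<^bsub>G\<^esub> g2 [^]\<^bsub>G\<^esub> z2 \<otimes>\<^bsub>G\<^esub> g3 [^]\<^bsub>G\<^esub> z3 = g}"

text \<open>There is one symbol for each distinct relation, so the relation serves as its own symbol.\<close>

definition lin3_vocabulary :: "('g, 'm) monoid_scheme \<Rightarrow> 'g list set vocabulary" where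
  "lin3_vocabulary G =
     \<lparr>symbols = {lin_rel G z1 z2 z3 g | z1 z2 z3 g. g \<in> carrier G}, arity = (\<lambda>_. 3)\<rparr>"

definition lin3_template :: "('g, 'm) monoid_scheme \<Rightarrow> ('g list set, 'g) rel_struct" where
  "lin3_template G = \<lparr>universe = carrier G, interp = (\<lambda>R. R)\<rparr>"


section \<open>Clauses\<close>

datatype 'v literal = Pos 'v | Neg 'v

type_synonym 'v clause = "'v literal set"

text \<open>The propositional variable $X(a,b)$ is the pair \<open>(a, b)\<close>.\<close>

definition CNF ::
  "'r vocabulary \<Rightarrow> ('r, 'a) rel_struct \<Rightarrow> ('r, 'b) rel_struct \<Rightarrow> ('a \<times> 'b) clause set" where
  "CNF V S T =
     {{Pos (a, b) | b. b \<in> universe T} | a. a \<in> universe S} \<union>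
     {{Neg (a, b0), Neg (a, b1)} | a b0 b1.
        a \<in> universe S \<and> b0 \<in> universe T \<and> b1 \<in> universe T \<and> b0 \<noteq> b1} \<union>
     {{Neg (as ! i, bs ! i) | i. i < arity V R} | R as bs.
        R \<in> symbols V \<and> as \<in> interp S R \<and> bs \<in> tuples (arity V R) (universe T) - interp T R}"


section \<open>Formulas in negation normal form\<close>

text \<open>\<open>Bot\<close> is the empty disjunction (the empty formula) and \<open>Top\<close> the empty conjunction.\<close>

datatype 'v form =
    Bot
  | Top
  | Lit "'v literal"
  | Or "'v form" "'v form"
  | And "'v form" "'v form"

fun complement_lit :: "'v literal \<Rightarrow> 'v literal" where
  "complement_lit (Pos x) = Neg x"
| "complement_lit (Neg x) = Pos x"

fun complement :: "'v form \<Rightarrow> 'v form" where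
  "complement Bot = Top"
| "complement Top = Bot"
| "complement (Lit l) = Lit (complement_lit l)"
| "complement (Or A B) = And (complement A) (complement B)"
| "complement (And A B) = Or (complement A) (complement B)"

fun literals :: "'v form \<Rightarrow> 'v literal set" where
  "literals Bot = {}"
| "literals Top = {}"
| "literals (Lit l) = {l}"
| "literals (Or A B) = literals A \<union> literals B"
| "literals (And A B) = literals A \<union> literals B"

fun form_size :: "'v form \<Rightarrow> nat" where
  "form_size Bot = 1"
| "form_size Top = 1"
| "form_size (Lit l) = 1"
| "form_size (Or A B) = 1 + form_size A + form_size B"
| "form_size (And A B) = 1 + form_size A + form_size B"

inductive disj_of :: "('v form \<Rightarrow> bool) \<Rightarrow> 'v form \<Rightarrow> bool" for P where
  "disj_of P Bot"
| "P A \<Longrightarrow> disj_of P A"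
| "disj_of P A \<Longrightarrow> disj_of P B \<Longrightarrow> disj_of P (Or A B)"

inductive conj_of :: "('v form \<Rightarrow> bool) \<Rightarrow> 'v form \<Rightarrow> bool" for P where
  "conj_of P Top"
| "P A \<Longrightarrow> conj_of P A"
| "conj_of P A \<Longrightarrow> conj_of P B \<Longrightarrow> conj_of P (And A B)"

lemma disj_of_mono [mono]: "P \<le> Q \<Longrightarrow> disj_of P \<le> disj_of Q"
proof
  fix A assume "P \<le> Q" "disj_of P A"
  from this(2,1) show "disj_of Q A"
    by (induction) (auto intro: disj_of.intros)
qed

lemma conj_of_mono [mono]: "P \<le> Q \<Longrightarrow> conj_of P \<le> conj_of Q"
proof
  fix A assume "P \<le> Q" "conj_of P A"
  from this(2,1) show "conj_of Q A"
    by (induction) (auto intro: conj_of.intros)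
qed

definition is_lit :: "'v form \<Rightarrow> bool" where
  "is_lit A \<longleftrightarrow> (\<exists>l. A = Lit l)"

definition k_term :: "nat \<Rightarrow> 'v form \<Rightarrow> bool" where
  "k_term k A \<longleftrightarrow> conj_of is_lit A \<and> card (literals A) \<le> k"

definition k_clause :: "nat \<Rightarrow> 'v form \<Rightarrow> bool" where
  "k_clause k A \<longleftrightarrow> disj_of is_lit A \<and> card (literals A) \<le> k"

text \<open>\<open>Sigma_form k t\<close> is the class $\Sigma_{t,k}$ and \<open>Pi_form k t\<close> the class $\Pi_{t,k}$.
  The levels start at $t = 1$; the classes are empty for $t \<le> 0$.\<close>

inductive Sigma_form :: "nat \<Rightarrow> int \<Rightarrow> 'v form \<Rightarrow> bool"
  and Pi_form :: "nat \<Rightarrow> int \<Rightarrow> 'v form \<Rightarrow> bool"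
  for k :: nat where
  "disj_of (k_term k) A \<Longrightarrow> Sigma_form k 1 A"
| "conj_of (k_clause k) A \<Longrightarrow> Pi_form k 1 A"
| "t \<ge> 2 \<Longrightarrow> disj_of (Pi_form k (t - 1)) A \<Longrightarrow> Sigma_form k t A"
| "t \<ge> 2 \<Longrightarrow> conj_of (Sigma_form k (t - 1)) A \<Longrightarrow> Pi_form k t A"


section \<open>Frege refutations\<close>

text \<open>The rules of the Tait-style system treat disjunction and conjunction as associative,
  commutative and idempotent, with the empty formula as unit (so that $C$ and $D$ in the rules may
  be absent).  As the connectives of \<open>form\<close> are binary, the rules are applied modulo the
  congruence generated by these identities.  Distributivity and absorption are not included.\<close>

inductive aci_eq :: "'v form \<Rightarrow> 'v form \<Rightarrow> bool" (infix \<open>\<approx>\<close> 50) where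
  aci_refl: "A \<approx> A"
| aci_sym: "A \<approx> B \<Longrightarrow> B \<approx> A"
| aci_trans: "A \<approx> B \<Longrightarrow> B \<approx> C \<Longrightarrow> A \<approx> C"
| or_cong: "A \<approx> A' \<Longrightarrow> B \<approx> B' \<Longrightarrow> Or A B \<approx> Or A' B'"
| or_assoc: "Or (Or A B) C \<approx> Or A (Or B C)"
| or_comm: "Or A B \<approx> Or B A"
| or_idem: "Or A A \<approx> A"
| or_unit: "Or A Bot \<approx> A"
| and_cong: "A \<approx> A' \<Longrightarrow> B \<approx> B' \<Longrightarrow> And A B \<approx> And A' B'"
| and_assoc: "And (And A B) C \<approx> And A (And B C)"
| and_comm: "And A B \<approx> And B A"
| and_idem: "And A A \<approx> A"
| and_unit: "And A Top \<approx> A"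

text \<open>\<open>frege_step H L F\<close>: the formula \<open>F\<close> is a hypothesis from the clause set \<open>H\<close>, or follows
  from the lines in \<open>L\<close> by one rule.\<close>

inductive frege_step :: "'v clause set \<Rightarrow> 'v form set \<Rightarrow> 'v form \<Rightarrow> bool"
  for H :: "'v clause set" and L :: "'v form set" where
  hypothesis: "disj_of is_lit F \<Longrightarrow> literals F \<in> H \<Longrightarrow> frege_step H L F"
| excluded_middle: "F \<approx> Or A (complement A) \<Longrightarrow> frege_step H L F"
| cut: "P \<in> L \<Longrightarrow> Q \<in> L \<Longrightarrow> P \<approx> Or C A \<Longrightarrow> Q \<approx> Or D (complement A) \<Longrightarrow>
    F \<approx> Or C D \<Longrightarrow> frege_step H L F"
| and_intro: "P \<in> L \<Longrightarrow> Q \<in> L \<Longrightarrow> P \<approx> Or C A \<Longrightarrow> Q \<approx> Or D B \<Longrightarrow>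
    F \<approx> Or (Or C D) (And A B) \<Longrightarrow> frege_step H L F"
| weakening: "C \<in> L \<Longrightarrow> F \<approx> Or C D \<Longrightarrow> frege_step H L F"

definition frege_refutation :: "'v clause set \<Rightarrow> 'v form list \<Rightarrow> bool" where
  "frege_refutation H \<pi> \<longleftrightarrow> \<pi> \<noteq> [] \<and> last \<pi> = Bot \<and>
     (\<forall>i < length \<pi>. frege_step H (set (take i \<pi>)) (\<pi> ! i))"

definition has_depth :: "int \<Rightarrow> 'v form list \<Rightarrow> bool" where
  "has_depth d \<pi> \<longleftrightarrow> (\<forall>F \<in> set \<pi>. Sigma_form 1 d F)"

definition refutation_size :: "'v form list \<Rightarrow> nat" where
  "refutation_size \<pi> = (\<Sum>F\<leftarrow>\<pi>. form_size F)"

end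

theory Submission
  imports Defs "HOL-Library.FSet" "HOL-Library.FuncSet" "HOL-Library.Nat_Bijection"
    "HOL-Real_Asymp.Real_Asymp"
begin

text \<open>
  The instances state the bijective pigeonhole principle over \<open>G\<close>: unknowns \<open>x\<^sub>i\<^sub>j\<close> for \<open>m + 1\<close> pigeons
  and \<open>m\<close> holes whose row products and column products all equal a fixed \<open>g \<noteq> \<one>\<close>, the products being
  cut into equations with three variables by means of prefix products.  Multiplying all rows and all
  columns gives \<open>g\<^sup>m\<^sup>+\<^sup>1 = g\<^sup>m\<close>.

  Under a matching of pigeons and holes every unknown, prefix products included, is determined by the
  partner of a single vertex, so each propositional variable has a matching decision tree of depth one.
  A switching lemma for random matchings, proved by Razborov's encoding argument, turns a disjunction
  of shallow trees into a shallow tree.  One restriction per level therefore gives every subformula of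
  a short refutation of bounded depth a tree of depth \<open>k\<close>.  Each equation only concerns three vertices,
  hence holds under every matching covering them; inductively no small matching refutes a line, but
  every matching refutes the empty formula.
\<close>

section \<open>Normal forms modulo associativity, commutativity and idempotence\<close>

text \<open>One surplus pigeon makes the argument uniform in \<open>G\<close>: cancelling
  \<open>g^m\<close> in \<open>g^(m+1) = g^m\<close> contradicts \<open>g \<noteq> \<one>\<close>
  whatever the order of \<open>g\<close>, and the local assignments use only the values
  \<open>\<one>\<close> and \<open>g\<close>. Since columns are constrained just like rows, holes
  can be queried as well as pigeons. The rules act modulo associativity, commutativity, idempotence
  and units, so a line has no fixed syntax tree. It is judged by the finite set of disjuncts of a
  canonical normal form, and only normal forms are evaluated. One parameter \<open>k\<close> is the
  depth of the trees, the width of the terms given to the switching lemma and the logarithm of the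
  assumed size: a union bound over \<open>2 ^ k\<close> subformulas needs a failure rate below
  \<open>2 ^ -k\<close>. A round raises the number of holes required to about its fifth power,
  bounded by the eighth; after \<open>d + 1\<close> rounds this leaves an exponent
  \<open>\<delta>\<close> of order \<open>8 ^ -(d + 1)\<close>.\<close>

text \<open>Signed formulas \<open>(b, c)\<close>, with \<open>b = False\<close> for negation; a conjunction is the negated disjunction of
  its negated conjuncts, so complementation flips the sign only.\<close>

datatype 'v core = Atom 'v | Disj "(bool \<times> 'v core) fset"

type_synonym 'v nform = "bool \<times> 'v core"

fun neg :: "'v nform \<Rightarrow> 'v nform" where
  "neg (b, c) = (\<not> b, c)"

lemma neg_neg [simp]: "neg (neg x) = x"
  by (cases x) simp

lemma snd_neg [simp]: "snd (neg x) = snd x"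
  by (cases x) simp

fun disjuncts :: "'v nform \<Rightarrow> 'v nform fset" where
  "disjuncts (True, Disj S) = S"
| "disjuncts x = {|x|}"

lemma disjuncts_other: "(\<nexists>S. x = (True, Disj S)) \<Longrightarrow> disjuncts x = {|x|}"
  by (cases x rule: disjuncts.cases) auto

lemma disjuncts_neg_Disj: "\<exists>S. x = (True, Disj S) \<Longrightarrow> disjuncts (neg x) = {|neg x|}"
  by auto

text \<open>Collapsing one-element disjunctions is forced by \<open>or_idem\<close> and
  \<open>or_unit\<close>: \<open>Or A A\<close> and \<open>A\<close> must receive the same normal
  form.\<close>

definition mk_disj :: "'v nform fset \<Rightarrow> 'v nform" where
  "mk_disj S = (if \<exists>x. S = {|x|} then THE x. S = {|x|} else (True, Disj S))"

lemma mk_disj_singleton [simp]: "mk_disj {|x|} = x"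
  by (auto simp: mk_disj_def)

lemma mk_disj_other: "(\<And>x. S \<noteq> {|x|}) \<Longrightarrow> mk_disj S = (True, Disj S)"
  by (auto simp: mk_disj_def)

fun nf :: "'v form \<Rightarrow> 'v nform" where
  "nf Bot = (True, Disj {||})"
| "nf Top = (False, Disj {||})"
| "nf (Lit (Pos v)) = (True, Atom v)"
| "nf (Lit (Neg v)) = (False, Atom v)"
| "nf (Or A B) = mk_disj (disjuncts (nf A) |\<union>| disjuncts (nf B))"
| "nf (And A B) = neg (mk_disj (disjuncts (neg (nf A)) |\<union>| disjuncts (neg (nf B))))"

definition flat :: "'v nform fset \<Rightarrow> bool" where
  "flat S \<longleftrightarrow> (\<forall>T. (True, Disj T) |\<notin>| S)"

text \<open>The invariant under which \<open>mk_disj\<close> and \<open>disjuncts\<close> undo each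
  other. The sign is free because a conjunction shares the core of its negation.\<close>

inductive canonical :: "'v nform \<Rightarrow> bool" where
  "canonical (b, Atom v)"
| "(\<And>x. S \<noteq> {|x|}) \<Longrightarrow> flat S \<Longrightarrow> (\<And>x. x |\<in>| S \<Longrightarrow> canonical x) \<Longrightarrow> canonical (b, Disj S)"

lemma canonical_neg [simp]: "canonical (neg x) \<longleftrightarrow> canonical x"
proof -
  have "canonical (neg x)" if "canonical x" for x :: "'a nform"
    using that by cases (simp_all add: canonical.intros)
  then show ?thesis by (metis neg_neg)
qed

lemma canonical_disjuncts:
  assumes "canonical x"
  shows "flat (disjuncts x)" "\<And>y. y |\<in>| disjuncts x \<Longrightarrow> canonical y"
    "disjuncts x = {|y|} \<Longrightarrow> x = y"
  using assms by (cases x rule: disjuncts.cases; auto simp: flat_def elim: canonical.cases; fail)+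

lemma mk_disj_disjuncts:
  assumes "canonical x"
  shows "mk_disj (disjuncts x) = x"
  using assms
proof (cases x rule: disjuncts.cases)
  case (1 S)
  then have "\<And>x. S \<noteq> {|x|}" using assms by (auto elim: canonical.cases)
  then show ?thesis using 1 mk_disj_other by auto
qed auto

lemma canonical_mk_disj:
  assumes "flat S" "\<And>y. y |\<in>| S \<Longrightarrow> canonical y"
  shows "canonical (mk_disj S)" "disjuncts (mk_disj S) = S"
proof -
  have "canonical (mk_disj S) \<and> disjuncts (mk_disj S) = S"
  proof (cases "\<exists>x. S = {|x|}")
    case True
    then obtain x where x: "S = {|x|}" by blast
    then have "disjuncts x = {|x|}" using assms(1) by (cases x rule: disjuncts.cases) (auto simp: flat_def)
    then show ?thesis using x assms(2)[of x] by simp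
  next
    case False
    then have e: "mk_disj S = (True, Disj S)" by (intro mk_disj_other) blast
    have "canonical (True, Disj S)" using False assms by (intro canonical.intros(2)) blast+
    then show ?thesis using e by simp
  qed
  then show "canonical (mk_disj S)" "disjuncts (mk_disj S) = S" by auto
qed

lemma flat_union: "flat S \<Longrightarrow> flat T \<Longrightarrow> flat (S |\<union>| T)"
  by (auto simp: flat_def)

lemma canonical_join:
  assumes "canonical x" "canonical y"
  shows "canonical (mk_disj (disjuncts x |\<union>| disjuncts y))"
    and "disjuncts (mk_disj (disjuncts x |\<union>| disjuncts y)) = disjuncts x |\<union>| disjuncts y"
  using assms canonical_disjuncts flat_union canonical_mk_disj[of "disjuncts x |\<union>| disjuncts y"]
  by (metis funionE)+

lemma canonical_nf: "canonical (nf F)"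
  by (induction F rule: nf.induct)
    (auto intro: canonical.intros canonical_join simp: flat_def)

lemma disjuncts_nf_Or: "disjuncts (nf (Or A B)) = disjuncts (nf A) |\<union>| disjuncts (nf B)"
  by (simp add: canonical_join canonical_nf)

lemma disjuncts_nf_And:
  "disjuncts (neg (nf (And A B))) = disjuncts (neg (nf A)) |\<union>| disjuncts (neg (nf B))"
  by (simp add: canonical_join canonical_nf)

lemma nf_complement: "nf (complement F) = neg (nf F)"
  by (induction F rule: nf.induct) auto

text \<open>Each law becomes a law of unions of finite sets. Idempotence and unit also have to
  rebuild a normal form from its disjuncts, which works because normal forms are canonical.\<close>

lemma nf_aci: "F \<approx> G \<Longrightarrow> nf F = nf G"
proof (induction rule: aci_eq.induct)
  case (or_assoc A B C)
  then show ?case by (simp only: nf.simps(5)[of "Or A B" C] nf.simps(5)[of A "Or B C"] disjuncts_nf_Or funion_assoc)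
next
  case (and_assoc A B C)
  then show ?case
    by (simp only: nf.simps(6)[of "And A B" C] nf.simps(6)[of A "And B C"] disjuncts_nf_And funion_assoc)
qed (simp_all add: mk_disj_disjuncts canonical_nf funion_commute)

lemma disjuncts_aci_Or: "F \<approx> Or A B \<Longrightarrow> disjuncts (nf F) = disjuncts (nf A) |\<union>| disjuncts (nf B)"
  using nf_aci disjuncts_nf_Or by metis

section \<open>Number of subformulas and alternation depth of normal forms\<close>

lemma size_core_member:
  assumes "x |\<in>| S"
  shows "size (snd x) < size (Disj S)"
proof -
  obtain b c where x: "x = (b, c)" by fastforce
  \<comment> \<open>The generated size of \<open>Disj S\<close> sums over the image of
    \<open>S\<close> under this map, and \<open>x\<close> supplies one summand.\<close>
  let ?f = "map_prod (\<lambda>b :: bool. b) (\<lambda>c :: 'a core. (c, size c))"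
  have "Suc (size_prod (\<lambda>_. 0) snd (?f x)) \<le> (\<Sum>y\<in>?f ` fset S. Suc (size_prod (\<lambda>_. 0) snd y))"
    by (rule member_le_sum[of "?f x"]) (use assms in auto)
  then show ?thesis by (simp add: x)
qed

text \<open>Subformulas without sign: a formula and its complement share their core, so one decision
  tree serves both.\<close>

function subcores :: "'v core \<Rightarrow> 'v core set" where
  "subcores (Atom v) = {Atom v}"
| "subcores (Disj S) = insert (Disj S) (\<Union>x\<in>fset S. subcores (snd x))"
  by pat_completeness auto
termination
  by (relation "measure size") (use size_core_member in auto)

lemma subcores_refl: "c \<in> subcores c"
  by (cases c) auto

lemma subcores_closed:
  "Disj S \<in> subcores c \<Longrightarrow> x |\<in>| S \<Longrightarrow> snd x \<in> subcores c"
  by (induction c rule: subcores.induct) (use subcores_refl in auto)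

lemma subcores_disjuncts: "y |\<in>| disjuncts x \<Longrightarrow> subcores (snd y) \<subseteq> subcores (snd x)"
  by (cases x rule: disjuncts.cases) auto

lemma subcores_mk_disj:
  "subcores (snd (mk_disj S)) \<subseteq> insert (snd (mk_disj S)) (\<Union>x\<in>fset S. subcores (snd x))"
proof (cases "\<exists>x. S = {|x|}")
  case False
  then have "mk_disj S = (True, Disj S)" by (intro mk_disj_other) blast
  then show ?thesis by simp
next
  case True
  then obtain x where "S = {|x|}" by blast
  then show ?thesis by (simp add: subset_insertI)
qed

text \<open>Normalising does not multiply subformulas: a connective adds at most one core, the
  merged disjunction, since its disjuncts were already present on one of the two sides. The size of
  a refutation thus bounds the number of cores to evaluate.\<close>

lemma card_subcores_nf: "finite (subcores (snd (nf F))) \<and> card (subcores (snd (nf F))) \<le> form_size F"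
proof -
  have step: "finite (subcores (snd z)) \<and> card (subcores (snd z)) \<le> 1 + a + b"
    if z: "z = mk_disj (disjuncts x |\<union>| disjuncts y)"
      and x: "finite (subcores (snd x)) \<and> card (subcores (snd x)) \<le> a"
      and y: "finite (subcores (snd y)) \<and> card (subcores (snd y)) \<le> b" for x y z :: "'a nform" and a b
  proof -
    let ?U = "insert (snd z) (subcores (snd x) \<union> subcores (snd y))"
    have "(\<Union>w\<in>fset (disjuncts x |\<union>| disjuncts y). subcores (snd w)) \<subseteq> subcores (snd x) \<union> subcores (snd y)"
    proof (rule UN_least)
      fix w assume "w \<in> fset (disjuncts x |\<union>| disjuncts y)"
      then have "w |\<in>| disjuncts x \<or> w |\<in>| disjuncts y" by (simp only: funion_iff)
      then show "subcores (snd w) \<subseteq> subcores (snd x) \<union> subcores (snd y)"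
        using subcores_disjuncts[of w x] subcores_disjuncts[of w y] by blast
    qed
    then have sub: "subcores (snd z) \<subseteq> ?U"
      unfolding z by (rule subset_trans[OF subcores_mk_disj insert_mono])
    have "card (subcores (snd z)) \<le> card ?U" using sub x y by (intro card_mono) auto
    also have "\<dots> \<le> Suc (card (subcores (snd x) \<union> subcores (snd y)))" by (rule card_insert_le_m1) auto
    also have "\<dots> \<le> Suc (card (subcores (snd x)) + card (subcores (snd y)))" by (simp add: card_Un_le)
    finally show ?thesis using x y finite_subset[OF sub] by auto
  qed
  show ?thesis
  proof (induction F rule: nf.induct)
    case (5 A B)
    show ?case using step[OF refl 5] by simp
  next
    case (6 A B)
    have *: "finite (subcores (snd (neg (nf A)))) \<and> card (subcores (snd (neg (nf A)))) \<le> form_size A"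
      "finite (subcores (snd (neg (nf B)))) \<and> card (subcores (snd (neg (nf B)))) \<le> form_size B"
      using 6 by auto
    show ?case using step[OF refl *] by simp
  qed auto
qed

text \<open>In a canonical core a disjunction lies directly inside another only under a negation, so
  nested occurrences of \<open>Disj\<close> count alternations of the connectives.\<close>

inductive level_le :: "nat \<Rightarrow> 'v core \<Rightarrow> bool" where
  atom: "level_le n (Atom v)"
| disj: "(\<And>x. x |\<in>| S \<Longrightarrow> level_le n (snd x)) \<Longrightarrow> level_le (Suc n) (Disj S)"

lemma level_le_mono: "level_le n c \<Longrightarrow> n \<le> m \<Longrightarrow> level_le m c"
proof (induction arbitrary: m rule: level_le.induct)
  case (disj S n)
  then show ?case by (cases m) (auto intro: level_le.disj)
qed (auto intro: level_le.atom)

lemma level_le_member: "level_le (Suc n) (Disj S) \<Longrightarrow> x |\<in>| S \<Longrightarrow> level_le n (snd x)"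
  by (erule level_le.cases) auto

lemma level_le_0: "level_le 0 c \<Longrightarrow> \<exists>v. c = Atom v"
  by (erule level_le.cases) auto

lemma level_le_subcores: "level_le n c \<Longrightarrow> c' \<in> subcores c \<Longrightarrow> level_le n c'"
proof (induction arbitrary: c' rule: level_le.induct)
  case (disj S n)
  then consider "c' = Disj S" | x where "x |\<in>| S" "c' \<in> subcores (snd x)" by auto
  then show ?case
  proof cases
    case 1
    then show ?thesis using disj.hyps by (auto intro: level_le.disj)
  next
    case 2
    then show ?thesis using disj.IH level_le_mono[of n c' "Suc n"] by auto
  qed
qed (auto intro: level_le.atom)

lemma level_le_disjuncts:
  "(\<And>y. y |\<in>| disjuncts x \<Longrightarrow> level_le n (snd y)) \<Longrightarrow> level_le (Suc n) (snd x)"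
  using level_le_mono[of n _ "Suc n"] by (cases x rule: disjuncts.cases) (auto intro: level_le.intros)

lemma level_le_disjuncts': "level_le n (snd x) \<Longrightarrow> y |\<in>| disjuncts x \<Longrightarrow> level_le n (snd y)"
  using level_le_subcores subcores_disjuncts subcores_refl by (metis subsetD)

lemma level_le_disj_of:
  assumes "disj_of P F" "\<And>A. P A \<Longrightarrow> level_le n (snd (nf A))"
  shows "level_le (Suc n) (snd (nf F))"
proof (rule level_le_disjuncts)
  fix y assume "y |\<in>| disjuncts (nf F)"
  with assms(1) show "level_le n (snd y)"
  proof induction
    case (3 A B)
    then show ?case unfolding disjuncts_nf_Or by auto
  next
    case (2 A)
    then show ?case using assms(2)[of A] level_le_disjuncts'[of n "nf A" y] by blast
  qed auto
qed

lemma level_le_conj_of: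
  assumes "conj_of P F" "\<And>A. P A \<Longrightarrow> level_le n (snd (nf A))"
  shows "level_le (Suc n) (snd (nf F))"
proof -
  have "level_le (Suc n) (snd (neg (nf F)))"
  proof (rule level_le_disjuncts)
    fix y assume "y |\<in>| disjuncts (neg (nf F))"
    with assms(1) show "level_le n (snd y)"
    proof induction
      case (2 A)
      then show ?case using assms(2)[of A] level_le_disjuncts'[of n "neg (nf A)" y] by simp
    next
      case (3 A B)
      then show ?case unfolding disjuncts_nf_And by auto
    qed auto
  qed
  then show ?thesis by simp
qed

lemma level_le_lit: "is_lit A \<Longrightarrow> level_le n (snd (nf A))"
  unfolding is_lit_def by (metis literal.exhaust nf.simps(3,4) snd_conv level_le.atom)

text \<open>The shift by one comes from the lowest level, where a \<open>k\<close>-DNF already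
  alternates twice: terms inside a disjunction.\<close>

lemma level_le_Sigma_Pi:
  shows "Sigma_form k t F \<Longrightarrow> level_le (Suc (nat t)) (snd (nf F))"
    and "Pi_form k t F \<Longrightarrow> level_le (Suc (nat t)) (snd (nf F))"
proof (induction rule: Sigma_form_Pi_form.inducts)
  case (1 A)
  have "level_le 1 (snd (nf B))" if "k_term k B" for B :: "'a form"
    using that level_le_conj_of[of is_lit B 0, OF _ level_le_lit] by (simp add: k_term_def)
  then show ?case using level_le_disj_of[OF 1] by simp
next
  case (2 A)
  have "level_le 1 (snd (nf B))" if "k_clause k B" for B :: "'a form"
    using that level_le_disj_of[of is_lit B 0, OF _ level_le_lit] by (simp add: k_clause_def)
  then show ?case using level_le_conj_of[OF 2] by simp
next
  case (3 t A)
  then have "Suc (nat (t - 1)) = nat t" by simp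
  then show ?case using 3 level_le_disj_of[of _ A "nat t"] by (metis (no_types, lifting))
next
  case (4 t A)
  then have "Suc (nat (t - 1)) = nat t" by simp
  then show ?case using 4 level_le_conj_of[of _ A "nat t"] by (metis (no_types, lifting))
qed

fun nlit :: "'v literal \<Rightarrow> 'v nform" where
  "nlit (Pos v) = (True, Atom v)"
| "nlit (Neg v) = (False, Atom v)"

lemma disjuncts_clause: "disj_of is_lit F \<Longrightarrow> fset (disjuncts (nf F)) = nlit ` literals F"
proof (induction rule: disj_of.induct)
  case (2 A)
  then obtain l where "A = Lit l" by (auto simp: is_lit_def)
  then show ?case by (cases l) auto
next
  case (3 A B)
  then show ?case unfolding disjuncts_nf_Or by (auto simp: image_Un)
qed auto

text \<open>Entries before \<open>x\<close> fail \<open>P\<close>, hence also the stronger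
  \<open>Q\<close>. Below, \<open>Q\<close> is compatibility with a larger matching.\<close>

lemma find_eq_SomeI:
  assumes "find P xs = Some x" "Q x" "\<And>y. Q y \<Longrightarrow> P y"
  shows "find Q xs = Some x"
  using assms by (induction xs) (auto split: if_splits)

lemma sum_Pow_power_card:
  fixes y :: real
  assumes "finite A"
  shows "(\<Sum>X\<in>Pow A. y ^ card X) = (1 + y) ^ card A"
  using assms
proof induction
  case empty
  then show ?case by simp
next
  case (insert a A)
  have "(\<Sum>X\<in>Pow (insert a A). y ^ card X)
      = (\<Sum>X\<in>Pow A. y ^ card X) + (\<Sum>X\<in>insert a ` Pow A. y ^ card X)"
    unfolding Pow_insert using insert by (intro sum.union_disjoint) auto
  also have "(\<Sum>X\<in>insert a ` Pow A. y ^ card X) = (\<Sum>X\<in>Pow A. y ^ card (insert a X))"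
    using insert by (subst sum.reindex) (auto simp: inj_on_def insert_ident)
  also have "\<dots> = (\<Sum>X\<in>Pow A. y * y ^ card X)"
    using insert finite_subset by (intro sum.cong refl) (subst card_insert_disjoint; auto)
  also have "\<dots> = y * (\<Sum>X\<in>Pow A. y ^ card X)" by (simp add: sum_distrib_left)
  finally show ?case using insert by (simp add: algebra_simps)
qed

section \<open>Matchings\<close>

locale bipartite =
  fixes D R :: "'v set"
  assumes finD: "finite D" and finR: "finite R" and DR: "D \<inter> R = {}"
    and cardD: "card D = Suc (card R)"
begin

text \<open>Edges are two-element sets, so \<open>\<Union>M\<close> is the set of matched vertices
  and both sides are treated alike.\<close>

definition edges :: "'v set set" where
  "edges = {{u, w} | u w. u \<in> D \<and> w \<in> R}"

definition matching :: "'v set set \<Rightarrow> bool" where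
  "matching M \<longleftrightarrow> M \<subseteq> edges \<and> pairwise disjnt M"

definition free_edges :: "'v set set \<Rightarrow> 'v set set" where
  "free_edges M = {e \<in> edges. e \<inter> \<Union>M = {}}"

lemma finite_edges: "finite edges"
proof -
  have "edges = (\<lambda>(u, w). {u, w}) ` (D \<times> R)"
    unfolding edges_def by auto
  then show ?thesis
    using finD finR by simp
qed

lemma finite_matchings: "finite {M. matching M}"
  by (rule finite_subset[of _ "Pow edges"]) (auto simp: matching_def finite_edges)

lemma matching_finite: "matching M \<Longrightarrow> finite M"
  unfolding matching_def using finite_edges finite_subset by blast

lemma matching_subset: "matching M \<Longrightarrow> N \<subseteq> M \<Longrightarrow> matching N"
  unfolding matching_def by (meson order_trans pairwise_subset)

lemma matching_empty: "matching {}"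
  by (simp add: matching_def)

lemma matching_insert:
  "matching M \<Longrightarrow> e \<in> free_edges M \<Longrightarrow> matching (insert e M)"
  unfolding matching_def free_edges_def pairwise_insert
  by (auto simp: disjnt_def)

lemma matching_unique:
  "matching M \<Longrightarrow> e \<in> M \<Longrightarrow> e' \<in> M \<Longrightarrow> v \<in> e \<Longrightarrow> v \<in> e' \<Longrightarrow> e = e'"
  unfolding matching_def pairwise_def disjnt_def by blast

lemma edge_nonempty: "e \<in> edges \<Longrightarrow> e \<noteq> {}"
  by (auto simp: edges_def)

lemma edge_subset: "e \<in> edges \<Longrightarrow> e \<subseteq> D \<union> R"
  by (auto simp: edges_def)

lemma card_edge_le: "e \<in> edges \<Longrightarrow> card e \<le> 2"
  by (auto simp: edges_def card_insert_if)

lemma free_notin: "e \<in> free_edges M \<Longrightarrow> e \<notin> M"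
  using edge_nonempty by (auto simp: free_edges_def)

lemma matching_disjoint_rest:
  assumes "matching M" "e \<in> M" "N \<subseteq> M" "e \<notin> N"
  shows "e \<in> free_edges N"
proof -
  have "e \<inter> f = {}" if "f \<in> N" for f
    using assms that matching_unique[OF assms(1,2), of f] by blast
  then show ?thesis using assms(1,2) by (auto simp: matching_def free_edges_def)
qed

lemma matching_un:
  assumes "matching M" "matching N" "\<Union>M \<inter> \<Union>N = {}"
  shows "matching (M \<union> N)"
proof -
  have "e \<inter> f = {}" if "e \<in> M \<union> N" "f \<in> M \<union> N" "e \<noteq> f" for e f
  proof -
    consider "e \<in> M" "f \<in> M" | "e \<in> N" "f \<in> N" | "e \<subseteq> \<Union>M" "f \<subseteq> \<Union>N" | "e \<subseteq> \<Union>N" "f \<subseteq> \<Union>M"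
      using \<open>e \<in> M \<union> N\<close> \<open>f \<in> M \<union> N\<close> by (meson UnE Union_upper)
    then show ?thesis
    proof cases
      case 1 then show ?thesis using assms(1) that(3) by (auto simp: matching_def pairwise_def disjnt_def)
    next
      case 2 then show ?thesis using assms(2) that(3) by (auto simp: matching_def pairwise_def disjnt_def)
    qed (use assms(3) in auto)
  qed
  then show ?thesis using assms(1,2) by (auto simp: matching_def pairwise_def disjnt_def)
qed

lemma matching_un_disjoint:
  assumes "matching (M \<union> N)" "M \<inter> N = {}"
  shows "\<Union>M \<inter> \<Union>N = {}"
proof (rule ccontr)
  assume "\<Union>M \<inter> \<Union>N \<noteq> {}"
  then obtain v e f where "v \<in> e" "e \<in> M" "v \<in> f" "f \<in> N" by auto
  then show False using matching_unique[OF assms(1), of e f v] assms(2) by auto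
qed

lemma card_Union_matching_le:
  assumes "matching M"
  shows "card (\<Union>M) \<le> 2 * card M"
proof -
  have "card (\<Union>M) \<le> (\<Sum>e\<in>M. card e)"
    by (rule card_Union_le_sum_card)
  also have "\<dots> \<le> (\<Sum>e\<in>M. 2)"
    using assms by (intro sum_mono card_edge_le) (auto simp: matching_def)
  finally show ?thesis by simp
qed

lemma finite_Union_matching:
  assumes "matching M"
  shows "finite (\<Union>M)"
proof (rule finite_subset)
  show "\<Union>M \<subseteq> D \<union> R" using assms edge_subset unfolding matching_def by blast
qed (simp add: finD finR)

lemma card_side_aux:
  assumes "matching M" "\<And>e. e \<in> edges \<Longrightarrow> card (X \<inter> e) = 1" "finite X"
  shows "card (X - \<Union>M) + card M = card X"
proof -
  have "card (X \<inter> \<Union>M) = card (\<Union>e\<in>M. X \<inter> e)"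
    by (simp only: Int_Union)
  also have "\<dots> = (\<Sum>e\<in>M. card (X \<inter> e))"
  proof (rule card_UN_disjoint)
    show "\<forall>e\<in>M. \<forall>f\<in>M. e \<noteq> f \<longrightarrow> (X \<inter> e) \<inter> (X \<inter> f) = {}"
    proof (intro ballI impI)
      fix e f assume "e \<in> M" "f \<in> M" "e \<noteq> f"
      then have "e \<inter> f = {}" using matching_unique[OF assms(1), of e f] by auto
      then show "(X \<inter> e) \<inter> (X \<inter> f) = {}" by auto
    qed
  qed (use assms matching_finite in auto)
  also have "\<dots> = (\<Sum>e\<in>M. 1)"
    using assms by (intro sum.cong) (auto simp: matching_def)
  finally have "card (X \<inter> \<Union>M) = card M" by simp
  moreover have "card X = card (X \<inter> \<Union>M) + card (X - \<Union>M)"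
    using assms(3) by (metis card_Int_Diff)
  ultimately show ?thesis by simp
qed

lemma card_freeD: "matching M \<Longrightarrow> card (D - \<Union>M) + card M = Suc (card R)"
proof -
  have "card (D \<inter> e) = 1" if "e \<in> edges" for e
  proof -
    obtain u w where "e = {u, w}" "u \<in> D" "w \<in> R" using \<open>e \<in> edges\<close> by (auto simp: edges_def)
    then have "D \<inter> e = {u}" using DR by auto
    then show ?thesis by simp
  qed
  then show "matching M \<Longrightarrow> ?thesis" using card_side_aux[of M D] finD cardD by simp
qed

lemma card_freeR: "matching M \<Longrightarrow> card (R - \<Union>M) + card M = card R"
proof -
  have "card (R \<inter> e) = 1" if "e \<in> edges" for e
  proof -
    obtain u w where "e = {u, w}" "u \<in> D" "w \<in> R" using \<open>e \<in> edges\<close> by (auto simp: edges_def)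
    then have "R \<inter> e = {w}" using DR by auto
    then show ?thesis by simp
  qed
  then show "matching M \<Longrightarrow> ?thesis" using card_side_aux[of M R] finR by simp
qed

lemma free_edge_exists:
  assumes "matching M" "card M < card R" "v \<in> D \<union> R" "v \<notin> \<Union>M"
  shows "\<exists>e\<in>free_edges M. v \<in> e"
proof -
  have "D - \<Union>M \<noteq> {}" "R - \<Union>M \<noteq> {}"
    using card_freeD[OF assms(1)] card_freeR[OF assms(1)] assms(2)
    by (metis add_0 card.empty lessI less_SucI less_irrefl, metis add_0 card.empty less_irrefl)
  then obtain u w where "u \<in> D - \<Union>M" "w \<in> R - \<Union>M" by blast
  then show ?thesis
  proof (cases "v \<in> D")
    case True
    then have "{v, w} \<in> free_edges M" using \<open>w \<in> R - \<Union>M\<close> assms(4) by (auto simp: free_edges_def edges_def)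
    then show ?thesis by blast
  next
    case False
    then have "{u, v} \<in> free_edges M" using \<open>u \<in> D - \<Union>M\<close> assms(3,4) by (auto simp: free_edges_def edges_def)
    then show ?thesis by blast
  qed
qed

lemma card_free_edges_at:
  assumes "matching M"
  shows "card {e \<in> free_edges M. v \<in> e} \<le> Suc (card R) - card M"
proof (cases "v \<in> D")
  case True
  have "{e \<in> free_edges M. v \<in> e} \<subseteq> (\<lambda>w. {v, w}) ` (R - \<Union>M)"
    using True DR by (auto simp: free_edges_def edges_def)
  then have "card {e \<in> free_edges M. v \<in> e} \<le> card (R - \<Union>M)"
    using finR by (meson finite_Diff surj_card_le)
  then show ?thesis using card_freeR[OF assms] by simp
next
  case False
  have "{e \<in> free_edges M. v \<in> e} \<subseteq> (\<lambda>u. {u, v}) ` (D - \<Union>M)"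
    using False DR by (auto simp: free_edges_def edges_def)
  then have "card {e \<in> free_edges M. v \<in> e} \<le> card (D - \<Union>M)"
    using finD by (meson finite_Diff surj_card_le)
  then show ?thesis using card_freeD[OF assms] by simp
qed

lemma card_free_edges:
  assumes "matching M"
  shows "card (free_edges M) \<le> (Suc (card R) - card M) * (Suc (card R) - card M)"
proof -
  have "free_edges M \<subseteq> (\<lambda>(u, w). {u, w}) ` ((D - \<Union>M) \<times> (R - \<Union>M))"
    by (auto simp: free_edges_def edges_def)
  then have "card (free_edges M) \<le> card ((D - \<Union>M) \<times> (R - \<Union>M))"
    using finD finR by (meson finite_Diff finite_SigmaI surj_card_le)
  also have "\<dots> = card (D - \<Union>M) * card (R - \<Union>M)" by (simp add: card_cartesian_product)
  also have "\<dots> \<le> (Suc (card R) - card M) * (Suc (card R) - card M)"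
    using card_freeD[OF assms] card_freeR[OF assms] by (intro mult_mono) auto
  finally show ?thesis .
qed

lemma matching_extend_card:
  assumes "matching M" "card M \<le> a" "a \<le> card R"
  shows "\<exists>N. matching N \<and> M \<subseteq> N \<and> card N = a"
  using assms(2,1,3)
proof (induction "a" rule: dec_induct)
  case base
  then show ?case by blast
next
  case (step a)
  then obtain N where N: "matching N" "M \<subseteq> N" "card N = a" by auto
  have "card (D - \<Union>N) \<noteq> 0" using card_freeD[OF N(1)] step N by simp
  then have "D - \<Union>N \<noteq> {}" by (metis card.empty)
  then obtain v where "v \<in> D" "v \<notin> \<Union>N" by blast
  then obtain e where "e \<in> free_edges N" using free_edge_exists[OF N(1), of v] step N by auto
  then have "matching (insert e N)" "card (insert e N) = Suc a" "M \<subseteq> insert e N"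
    using N matching_insert matching_finite free_notin by auto
  then show ?case by blast
qed

section \<open>Matching decision trees\<close>

text \<open>No tree is represented: starting from the known matching \<open>M\<close>, a querier can
  force it into \<open>S\<close> by \<open>k\<close> queries. A query of a vertex without free edges
  succeeds vacuously; lemmas that follow a branch therefore bound matchings by
  \<open>card R\<close>.\<close>

inductive decision_tree :: "'v set set set \<Rightarrow> nat \<Rightarrow> 'v set set \<Rightarrow> bool" for S where
  leaf: "M \<in> S \<Longrightarrow> decision_tree S k M"
| query: "v \<in> D \<union> R \<Longrightarrow> v \<notin> \<Union>M \<Longrightarrow> (\<And>e. e \<in> free_edges M \<Longrightarrow> v \<in> e \<Longrightarrow> decision_tree S k (insert e M))
    \<Longrightarrow> decision_tree S (Suc k) M"

definition up_closed :: "'v set set set \<Rightarrow> bool" where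
  "up_closed S \<longleftrightarrow> (\<forall>M\<in>S. \<forall>N. M \<subseteq> N \<and> matching N \<longrightarrow> N \<in> S)"

lemma up_closedD: "up_closed S \<Longrightarrow> M \<in> S \<Longrightarrow> M \<subseteq> N \<Longrightarrow> matching N \<Longrightarrow> N \<in> S"
  by (auto simp: up_closed_def)

lemma decision_tree_mono: "decision_tree S k M \<Longrightarrow> S \<inter> {N. M \<subseteq> N} \<subseteq> T \<Longrightarrow> k \<le> l \<Longrightarrow> decision_tree T l M"
proof (induction arbitrary: l rule: decision_tree.induct)
  case (leaf M k)
  then show ?case by (intro decision_tree.leaf) auto
next
  case (query v M k)
  then obtain l' where l: "l = Suc l'" "k \<le> l'" by (cases l) auto
  show ?case unfolding l
    by (rule decision_tree.query[of v]) (use query l in \<open>auto intro!: query.IH\<close>)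
qed

text \<open>Queries are answered by \<open>P\<close> where it covers the queried vertex, and by a
  new free edge added to \<open>P\<close> elsewhere. The leaf \<open>t\<close> collects the answers
  only, so its size is measured from \<open>M\<close> and not from \<open>P\<close>.\<close>

lemma decision_tree_walk:
  assumes "decision_tree S k M" "M \<subseteq> P" "matching P" "card P + k \<le> card R"
  shows "\<exists>Q t. matching Q \<and> P \<subseteq> Q \<and> card Q \<le> card P + k \<and> M \<subseteq> t \<and> t \<subseteq> Q \<and> t \<in> S
    \<and> card t \<le> card M + k"
  using assms
proof (induction arbitrary: P rule: decision_tree.induct)
  case (leaf M k)
  then show ?case by (intro exI[of _ P] exI[of _ M]) auto
next
  case (query v M k)
  have "\<exists>e P'. e \<in> free_edges M \<and> v \<in> e \<and> insert e M \<subseteq> P' \<and> P \<subseteq> P' \<and> matching P' \<and> card P' \<le> Suc (card P)"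
  proof (cases "v \<in> \<Union>P")
    case True
    then obtain e where "e \<in> P" "v \<in> e" by auto
    moreover have "e \<in> free_edges M"
      using matching_disjoint_rest[OF query.prems(2) \<open>e \<in> P\<close> query.prems(1)] query \<open>v \<in> e\<close> by blast
    ultimately show ?thesis using query.prems by (intro exI[of _ e] exI[of _ P]) auto
  next
    case False
    then obtain e where e: "e \<in> free_edges P" "v \<in> e" 
      using free_edge_exists[OF query.prems(2), of v] query by auto
    then have "e \<in> free_edges M" using query.prems unfolding free_edges_def by blast
    then show ?thesis using e query.prems matching_insert[OF _ e(1)] matching_finite
      by (intro exI[of _ e] exI[of _ "insert e P"]) (auto simp: card_insert_if)
  qed
  then obtain e P' where *: "e \<in> free_edges M" "v \<in> e" "insert e M \<subseteq> P'" "P \<subseteq> P'" "matching P'"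
    "card P' \<le> Suc (card P)" by blast
  have "card P' + k \<le> card R" using * query.prems by simp
  from query.IH[OF *(1,2,3,5) this] obtain Q t where Q: "matching Q" "P' \<subseteq> Q" "card Q \<le> card P' + k"
    "insert e M \<subseteq> t" "t \<subseteq> Q" "t \<in> S" "card t \<le> card (insert e M) + k" by blast
  have "card (insert e M) \<le> Suc (card M)" by (rule card_insert_le_m1) auto
  then show ?case using Q * by (intro exI[of _ Q] exI[of _ t]) auto
qed

text \<open>Queries of vertices covered by \<open>P\<close> have a known answer and are skipped; the
  others keep those branches that are compatible with \<open>P\<close>.\<close>

lemma decision_tree_restrict:
  assumes "decision_tree S k M" "M \<subseteq> P" "matching P" "up_closed S"
  shows "decision_tree S k P"
  using assms(1-3)
proof (induction arbitrary: P rule: decision_tree.induct)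
  case (leaf M k)
  then show ?case using assms(4) by (auto intro: decision_tree.leaf up_closedD)
next
  case (query v M k)
  show ?case
  proof (cases "v \<in> \<Union>P")
    case True
    then obtain e where e: "e \<in> P" "v \<in> e" by auto
    then have "e \<in> free_edges M"
      using matching_disjoint_rest[OF query.prems(2) \<open>e \<in> P\<close> query.prems(1)] query by blast
    then have "decision_tree S k P" using query.IH[of e P] e query.prems by auto
    then show ?thesis by (rule decision_tree_mono) auto
  next
    case False
    show ?thesis
    proof (rule decision_tree.query[of v])
      fix e assume e: "e \<in> free_edges P" "v \<in> e"
      then have "e \<in> free_edges M" using query.prems unfolding free_edges_def by blast
      then show "decision_tree S k (insert e P)" using query.IH[of e "insert e P"] e query.prems matching_insert
        by auto
    qed (use False query in auto)
  qed
qed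

section \<open>A switching lemma for matchings\<close>

text \<open>The depth is an integer: a budget that has become negative counts as exceeded, which lets the
  walk down a tree below overshoot by the edges of one term.\<close>

definition deep :: "'v set set set \<Rightarrow> int \<Rightarrow> 'v set set \<Rightarrow> bool" where
  "deep S s M \<longleftrightarrow> s < 0 \<or> \<not> decision_tree S (nat s) M"

text \<open>The sets of answers obtainable by querying all of \<open>W\<close> below
  \<open>M\<close>; an edge inside \<open>W\<close> answers two vertices at once.\<close>

definition cover :: "'v set set \<Rightarrow> 'v set \<Rightarrow> 'v set set set" where
  "cover M W = {P. matching (M \<union> P) \<and> M \<inter> P = {} \<and> (\<forall>e\<in>P. e \<inter> W \<noteq> {}) \<and> W \<subseteq> \<Union>P}"

text \<open>Were all branches at a vertex shallow, querying it would give a shallow tree. So some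
  answer stays deep with a budget smaller by one; a vertex of \<open>W\<close> covered by that
  answer needs no query of its own.\<close>

lemma deep_cover:
  assumes "finite W" "W \<subseteq> D \<union> R" "W \<inter> \<Union>M = {}" "matching M"
    "card M + card W \<le> card R" "deep S s M"
  shows "\<exists>P\<in>cover M W. deep S (s - int (card P)) (M \<union> P)"
  using assms
proof (induction W arbitrary: M s rule: finite_psubset_induct)
  case (psubset W)
  show ?case
  proof (cases "W = {}")
    case True
    then show ?thesis using psubset.prems by (intro bexI[of _ "{}"]) (auto simp: cover_def)
  next
    case False
    then obtain v where v: "v \<in> W" by blast
    have cW: "card W > 0" using False psubset.hyps by auto
    have v': "v \<in> D \<union> R" "v \<notin> \<Union>M" using v psubset.prems by auto
    obtain e0 where e0: "e0 \<in> free_edges M" "v \<in> e0"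
      using free_edge_exists[OF psubset.prems(3) _ v'] psubset.prems(4) cW by auto
    have "\<exists>e. e \<in> free_edges M \<and> v \<in> e \<and> deep S (s - 1) (insert e M)"
    proof (cases "s \<le> 0")
      \<comment> \<open>Below zero every matching counts as deep, so any answer will do.\<close>
      case True
      then show ?thesis using e0 by (auto simp: deep_def)
    next
      case False
      then have s: "nat s = Suc (nat (s - 1))" by simp
      have "\<not> decision_tree S (nat s) M" using psubset.prems(5) False by (auto simp: deep_def)
      then show ?thesis using decision_tree.query[OF v', of S "nat (s - 1)"] unfolding s deep_def by blast
    qed
    then obtain e where e: "e \<in> free_edges M" "v \<in> e" "deep S (s - 1) (insert e M)" by blast
    let ?M = "insert e M" and ?W = "W - e"
    have sub: "?W \<subset> W" using v e by auto
    have cWe: "card ?W < card W" by (rule psubset_card_mono[OF psubset.hyps sub])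
    have M': "matching ?M" using matching_insert psubset.prems(3) e by blast
    have cM: "card ?M = Suc (card M)"
      using matching_finite[OF psubset.prems(3)] free_notin[OF e(1)] by simp
    have "\<exists>P\<in>cover ?M ?W. deep S (s - 1 - int (card P)) (?M \<union> P)"
      using psubset.prems e M' cM cWe by (intro psubset.IH[OF sub]) auto
    then obtain P where P: "P \<in> cover ?M ?W" "deep S (s - 1 - int (card P)) (?M \<union> P)" by blast
    have "e \<notin> P" "finite P" using P matching_finite[of "?M \<union> P"] by (auto simp: cover_def)
    then have "card (insert e P) = Suc (card P)" by simp
    then have "deep S (s - int (card (insert e P))) (M \<union> insert e P)" using P by (simp add: algebra_simps)
    moreover have "insert e P \<in> cover M W"
    proof -
      have "W \<subseteq> \<Union>(insert e P)" "\<forall>f\<in>insert e P. f \<inter> W \<noteq> {}"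
        using P(1) e v unfolding cover_def by blast+
      moreover have "matching (M \<union> insert e P)" "M \<inter> insert e P = {}"
        using P(1) free_notin[OF e(1)] by (auto simp: cover_def)
      ultimately show ?thesis by (simp add: cover_def)
    qed
    ultimately show ?thesis by blast
  qed
qed

lemma cover_subset_edges:
  assumes "P \<in> cover M W" "e \<in> P"
  shows "e \<in> free_edges M"
  using assms matching_disjoint_rest[of "M \<union> P" e M] by (auto simp: cover_def)

lemma cover_card_le:
  assumes "P \<in> cover M W" "finite W"
  shows "card P \<le> card W"
proof -
  have "\<forall>e\<in>P. \<exists>v. v \<in> e \<inter> W" using assms by (auto simp: cover_def)
  then obtain f where f: "\<And>e. e \<in> P \<Longrightarrow> f e \<in> e \<inter> W" by metis
  have m: "matching P" using assms matching_subset[of "M \<union> P" P] by (auto simp: cover_def)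
  have "inj_on f P"
  proof (rule inj_onI)
    fix x y assume "x \<in> P" "y \<in> P" "f x = f y"
    then show "x = y" using matching_unique[OF m, of x y "f x"] f[of x] f[of y] by auto
  qed
  then show ?thesis using f assms by (intro card_inj_on_le[of f]) auto
qed

text \<open>\<open>P\<close> is recovered from the function that sends each vertex of
  \<open>W\<close> to its edge in \<open>P\<close>, and each vertex has few free edges to choose
  from.\<close>

lemma card_cover:
  assumes "matching M" "finite W"
  shows "finite (cover M W)" "card (cover M W) \<le> (Suc (card R) - card M) ^ card W"
proof -
  let ?B = "\<lambda>v. {e \<in> free_edges M. v \<in> e}"
  define f where "f P = restrict (\<lambda>v. THE e. e \<in> P \<and> v \<in> e) W" for P :: "'v set set"
  have f: "f P v \<in> P \<and> v \<in> f P v" if P: "P \<in> cover M W" and v: "v \<in> W" for P v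
  proof -
    have m: "matching P" using P matching_subset[of "M \<union> P" P] by (auto simp: cover_def)
    obtain e where "e \<in> P" "v \<in> e" using P v unfolding cover_def by blast
    then have "(THE e. e \<in> P \<and> v \<in> e) \<in> P \<and> v \<in> (THE e. e \<in> P \<and> v \<in> e)"
      using matching_unique[OF m] by (intro theI[of "\<lambda>e. e \<in> P \<and> v \<in> e" e]) auto
    then show ?thesis using v by (simp add: f_def)
  qed
  have img: "P = f P ` W" if P: "P \<in> cover M W" for P
  proof
    show "f P ` W \<subseteq> P" using f[OF P] by blast
    show "P \<subseteq> f P ` W"
    proof
      fix e assume e: "e \<in> P"
      then obtain v where v: "v \<in> e" "v \<in> W" using P unfolding cover_def by blast
      have m: "matching P" using P matching_subset[of "M \<union> P" P] by (auto simp: cover_def)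
      have "f P v = e" using f[OF P v(2)] matching_unique[OF m _ e _ v(1)] by blast
      then show "e \<in> f P ` W" using v by blast
    qed
  qed
  have fin: "finite (?B v)" for v
    by (rule finite_subset[OF _ finite_edges]) (auto simp: free_edges_def)
  have inj: "inj_on f (cover M W)" by (metis img inj_onI)
  have "f P \<in> PiE W ?B" if "P \<in> cover M W" for P
  proof (rule PiE_I)
    fix v assume "v \<in> W"
    then show "f P v \<in> ?B v" using f[OF that] cover_subset_edges[OF that] by blast
  qed (simp add: f_def)
  then have sub: "f ` cover M W \<subseteq> PiE W ?B" by blast
  have finPi: "finite (PiE W ?B)" using assms fin by (intro finite_PiE) auto
  show "finite (cover M W)" by (rule inj_on_finite[OF inj sub finPi])
  have "card (cover M W) \<le> card (PiE W ?B)" by (rule card_inj_on_le[OF inj sub finPi])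
  also have "\<dots> = (\<Prod>v\<in>W. card (?B v))" by (rule card_PiE[OF assms(2)])
  also have "\<dots> \<le> (\<Prod>v\<in>W. Suc (card R) - card M)"
    using card_free_edges_at[OF assms(1)] by (intro prod_mono) auto
  finally show "card (cover M W) \<le> (Suc (card R) - card M) ^ card W" by simp
qed

text \<open>Terms are matchings, read as conjunctions of their edges; these are the restrictions
  that make the disjunction of the terms in \<open>F\<close> constant.\<close>

definition decided :: "'v set set set \<Rightarrow> 'v set set set" where
  "decided F = {M. matching M \<and> ((\<exists>t\<in>F. t \<subseteq> M) \<or> (\<forall>t\<in>F. \<not> matching (t \<union> M)))}"

abbreviation first_live :: "'v set set list \<Rightarrow> 'v set set \<Rightarrow> 'v set set option" where
  "first_live ts M \<equiv> find (\<lambda>t. matching (t \<union> M)) ts"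

text \<open>Razborov's decoder.  A canonical tree repeatedly queries all vertices of the first term \<open>C\<close> not yet
  falsified.  A restriction without shallow tree is encoded by adding to it the part \<open>X\<close> of each such
  term that makes the term true; adding later parts does not change which term comes first.  The
  decoder finds \<open>C\<close>, replaces \<open>X\<close> by the answers \<open>P\<close> of the tree, and continues; the number \<open>j\<close> counts the
  added edges.\<close>

inductive decodes :: "'v set set \<Rightarrow> 'v set set list \<Rightarrow> nat \<Rightarrow> 'v set set \<Rightarrow> 'v set set \<Rightarrow> bool"
  for \<rho> ts where
  stop: "decodes \<rho> ts 0 T T"
| block: "first_live ts T = Some C \<Longrightarrow> X \<subseteq> C - \<rho> \<Longrightarrow> X \<noteq> {} \<Longrightarrow> P \<in> cover (T - X) (\<Union>X) \<Longrightarrow>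
    decodes \<rho> ts j (T - X \<union> P) N \<Longrightarrow> decodes \<rho> ts (card X + j) T (N - P)"

text \<open>Terms contain the restriction \<open>\<rho>\<close> already in force; only edges beyond
  it count towards the width \<open>r\<close>.\<close>

definition terms_over :: "'v set set \<Rightarrow> nat \<Rightarrow> 'v set set set" where
  "terms_over \<rho> r = {t. matching t \<and> \<rho> \<subseteq> t \<and> card t \<le> card \<rho> + r}"

lemma terms_over_card:
  assumes "t \<in> terms_over \<rho> r"
  shows "finite t" "card (t - \<rho>) \<le> r"
proof -
  show "finite t" using assms matching_finite by (auto simp: terms_over_def)
  then have "card (t - \<rho>) = card t - card \<rho>" using assms finite_subset
    by (intro card_Diff_subset) (auto simp: terms_over_def)
  then show "card (t - \<rho>) \<le> r" using assms by (auto simp: terms_over_def)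
qed

text \<open>A part \<open>X1\<close> of a term touches at most \<open>2 * card X1\<close> vertices,
  so at most that many answers are spent on it. The recursion stops once more than \<open>s\<close>
  answers have been given, whence \<open>s < 2 * card X\<close>. The margin \<open>2 * r\<close>
  ensures that the last term can still be queried completely.\<close>

lemma deep_encoding:
  assumes ts: "set ts \<subseteq> terms_over \<rho> r"
    and "\<rho> \<subseteq> M" "matching M" "deep (decided (set ts)) s M" "int (card M) + s + 2 * int r \<le> int (card R)"
  shows "\<exists>X. matching (M \<union> X) \<and> M \<inter> X = {} \<and> s < 2 * int (card X) \<and> decodes \<rho> ts (card X) (M \<union> X) M"
  using assms(2-)
proof (induction "nat (s + 1)" arbitrary: s M rule: less_induct)
  case less
  show ?case
  proof (cases "s < 0")
    case True
    then show ?thesis using less.prems by (intro exI[of _ "{}"]) (auto intro: decodes.stop)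
  next
    case False
    let ?F = "set ts"
    have "M \<notin> decided ?F" using less.prems(3) False decision_tree.leaf by (auto simp: deep_def)
    then have no: "\<And>t. t \<in> ?F \<Longrightarrow> \<not> t \<subseteq> M" and ex: "\<exists>t\<in>?F. matching (t \<union> M)"
      using less.prems(2) by (auto simp: decided_def)
    from ex have "first_live ts M \<noteq> None" by (auto simp: find_None_iff)
    then obtain C where C: "first_live ts M = Some C" by auto
    then have CF: "C \<in> ?F" and mC: "matching (C \<union> M)"
      by (auto simp: find_Some_iff)
    define X1 where "X1 = C - M"
    have X1: "X1 \<noteq> {}" "X1 \<subseteq> C - \<rho>" "M \<inter> X1 = {}" "M \<union> X1 = C \<union> M"
      using no[OF CF] less.prems(1) by (auto simp: X1_def)
    have mX1: "matching X1" using mC matching_subset X1_def by blast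
    have fX1: "finite X1" using mX1 matching_finite by blast
    have "card X1 \<le> card (C - \<rho>)"
      using X1(2) terms_over_card(1)[of C] CF ts by (intro card_mono) auto
    then have cX1: "card X1 \<le> r" using terms_over_card(2)[of C] CF ts by force
    let ?W = "\<Union>X1"
    have W: "?W \<inter> \<Union>M = {}" using matching_un_disjoint[of M X1] mC X1 by auto
    have cW: "card ?W \<le> 2 * card X1" by (rule card_Union_matching_le[OF mX1])
    have fW: "finite ?W" by (rule finite_Union_matching[OF mX1])
    have WDR: "?W \<subseteq> D \<union> R" using mX1 edge_subset unfolding matching_def by blast
    have "card M + card ?W \<le> card R" using less.prems(4) False cW cX1 by linarith
    then obtain P where P: "P \<in> cover M ?W" "deep (decided ?F) (s - int (card P)) (M \<union> P)"
      using deep_cover[OF fW WDR W less.prems(2) _ less.prems(3)] by blast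
    have mP: "matching (M \<union> P)" "M \<inter> P = {}" "?W \<subseteq> \<Union>P" "\<forall>e\<in>P. e \<inter> ?W \<noteq> {}"
      using P(1) by (auto simp: cover_def)
    have fP: "finite P" using matching_finite[OF mP(1)] by simp
    obtain e where e: "e \<in> X1" using X1 by blast
    then have "e \<noteq> {}" using edge_nonempty mX1 by (auto simp: matching_def)
    then have "P \<noteq> {}" using mP e by blast
    then have cP: "card P > 0" using fP by auto
    have cMP: "card (M \<union> P) = card M + card P"
      using matching_finite[OF less.prems(2)] fP mP by (simp add: card_Un_disjoint)
    have cPX: "card P \<le> 2 * card X1" using cover_card_le[OF P(1) fW] cW by simp
    have "nat (s - int (card P) + 1) < nat (s + 1)" using cP False by simp
    moreover have "\<rho> \<subseteq> M \<union> P" using less.prems(1) by auto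
    moreover have "int (card (M \<union> P)) + (s - int (card P)) + 2 * int r \<le> int (card R)"
      using cMP less.prems(4) by simp
    ultimately obtain X2 where X2: "matching (M \<union> P \<union> X2)" "(M \<union> P) \<inter> X2 = {}"
      "s - int (card P) < 2 * int (card X2)" "decodes \<rho> ts (card X2) (M \<union> P \<union> X2) (M \<union> P)"
      using less.hyps[OF _ _ mP(1) P(2)] by blast
    have dis: "\<Union>(M \<union> P) \<inter> \<Union>X2 = {}" using matching_un_disjoint[OF X2(1,2)] .
    have fX2: "finite X2" using matching_finite[OF X2(1)] by simp
    have mX2: "matching X2" using X2(1) matching_subset by blast
    \<comment> \<open>\<open>P\<close> covers every vertex of \<open>X1\<close>, so the later edges
      \<open>X2\<close> avoid the vertices of \<open>C\<close> and can join a matching that contains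
      \<open>C\<close>.\<close>
    have dis': "\<Union>(C \<union> M) \<inter> \<Union>X2 = {}"
    proof -
      have "\<Union>(C \<union> M) \<subseteq> \<Union>(M \<union> P)" using mP(3) X1_def by auto
      then show ?thesis using dis by blast
    qed
    have X12: "X1 \<inter> X2 = {}"
    proof (rule ccontr)
      assume "X1 \<inter> X2 \<noteq> {}"
      then obtain f where "f \<in> X1" "f \<in> X2" by blast
      moreover have "f \<noteq> {}" using \<open>f \<in> X1\<close> edge_nonempty mX1 by (auto simp: matching_def)
      ultimately show False using dis' X1_def by blast
    qed
    let ?X = "X1 \<union> X2"
    have mT: "matching (M \<union> ?X)"
      using matching_un[OF mC mX2 dis'] X1(4) by (metis Un_assoc)
    \<comment> \<open>\<open>C\<close> is part of the enlarged matching, hence live; earlier terms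
      were dead at \<open>M\<close> and stay dead.\<close>
    have fst: "first_live ts (M \<union> ?X) = Some C"
    proof (rule find_eq_SomeI[OF C])
      have "C \<union> (M \<union> ?X) = M \<union> ?X" using X1_def by auto
      then show "matching (C \<union> (M \<union> ?X))" using mT by simp
    next
      fix y assume "matching (y \<union> (M \<union> ?X))"
      then show "matching (y \<union> M)" by (rule matching_subset) auto
    qed
    have TX: "M \<union> ?X - X1 = M \<union> X2" using X1(3) X12 by auto
    have Pc: "P \<in> cover (M \<union> ?X - X1) ?W"
      unfolding TX cover_def using mP X2(1,2) matching_subset
      by (auto simp: Un_ac)
    have "M \<union> ?X - X1 \<union> P = M \<union> P \<union> X2" using TX by auto
    then have "decodes \<rho> ts (card X1 + card X2) (M \<union> ?X) ((M \<union> P) - P)"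
      using X2(4) by (intro decodes.block[OF fst X1(2,1) Pc]) simp
    moreover have "(M \<union> P) - P = M" using mP(2) by auto
    moreover have "card X1 + card X2 = card ?X" using X12 fX1 fX2 by (simp add: card_Un_disjoint)
    moreover have "M \<inter> ?X = {}" using X1(3) X2(2) by auto
    moreover have "s < 2 * int (card X1 + card X2)" using X2(3) cPX by simp
    ultimately show ?thesis using mT by (intro exI[of _ ?X]) simp
  qed
qed

text \<open>Let \<open>B = 2 * r * (l + 1)^2\<close>. A block is given by \<open>X\<close> and
  \<open>P\<close>, with at most \<open>(l + 1)^(2 * card X)\<close> choices of \<open>P\<close>. By
  induction the count is at most \<open>B^j\<close> times the sum of
  \<open>(1 / (2 * r))^card X\<close> over nonempty \<open>X\<close>, and this sum is at most
  \<open>(1 + 1 / (2 * r))^r - 1 \<le> exp (1 / 2) - 1 \<le> 1\<close>; hence the factor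
  \<open>2 * r\<close>. The size hypothesis says that at most \<open>l + 1\<close> vertices per side
  are free even after \<open>j\<close> edges are removed from \<open>T\<close>; a block preserves
  it, as \<open>j\<close> drops by \<open>card X\<close> and \<open>T\<close> loses at most as many
  edges.\<close>

lemma card_decodes:
  assumes ts: "set ts \<subseteq> terms_over \<rho> r" and r: "r \<ge> 1"
    and "matching T" "card R + j \<le> l + card T"
  shows "finite {N. decodes \<rho> ts j T N} \<and>
    real (card {N. decodes \<rho> ts j T N}) \<le> (2 * real r * real (l + 1) ^ 2) ^ j"
  using assms(3-)
proof (induction j arbitrary: T rule: less_induct)
  case (less j)
  let ?L = "real (l + 1)"
  let ?B = "2 * real r * ?L ^ 2"
  have L: "?L \<ge> 1" by simp
  have B: "?B > 0" using r by simp
  have pos: "card X > 0" if "first_live ts S = Some C" "X \<subseteq> C - \<rho>" "X \<noteq> {}" for X S C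
  proof -
    have "C \<in> set ts" using that(1) by (auto simp: find_Some_iff)
    then show ?thesis using terms_over_card(1)[of C] that ts finite_subset[of X C]
      by (metis Diff_subset card_gt_0_iff subset_iff subset_trans)
  qed
  show ?case
  proof (cases "first_live ts T")
    case None
    then have "{N. decodes \<rho> ts j T N} \<subseteq> {T}"
      by (auto elim: decodes.cases)
    moreover have "{N. decodes \<rho> ts j T N} = {}" if "j > 0"
      using None that by (auto elim: decodes.cases)
    ultimately show ?thesis using finite_subset[of _ "{T}"] card_mono[of "{T}" "{N. decodes \<rho> ts j T N}"]
      by (cases "j = 0") (force simp: Let_def)+
  next
    case (Some C)
    have C: "C \<in> terms_over \<rho> r" using Some ts by (auto simp: find_Some_iff)
    have fC: "finite C" and cC: "card (C - \<rho>) \<le> r" using terms_over_card[OF C] by auto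
    show ?thesis
    proof (cases "j = 0")
      case True
      have "N = T" if "decodes \<rho> ts 0 T N" for N
        using that
      proof cases
        case (block C' X P j' N')
        then show ?thesis using pos[OF block(3,4,5)] by simp
      qed
      then have "{N. decodes \<rho> ts 0 T N} \<subseteq> {T}" by auto
      then show ?thesis using True card_mono[of "{T}" "{N. decodes \<rho> ts j T N}"] finite_subset[of _ "{T}"]
        by auto
    next
      case False
      let ?I = "{X. X \<subseteq> C - \<rho> \<and> X \<noteq> {} \<and> card X \<le> j}"
      let ?P = "\<lambda>X. cover (T - X) (\<Union>X)"
      let ?N = "\<lambda>X P. (\<lambda>N. N - P) ` {N. decodes \<rho> ts (j - card X) (T - X \<union> P) N}"
      have sub: "{N. decodes \<rho> ts j T N} \<subseteq> (\<Union>X\<in>?I. \<Union>P\<in>?P X. ?N X P)"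
      proof
        fix N assume "N \<in> {N. decodes \<rho> ts j T N}"
        then have "decodes \<rho> ts j T N" by simp
        then show "N \<in> (\<Union>X\<in>?I. \<Union>P\<in>?P X. ?N X P)"
        proof cases
          case stop
          then show ?thesis using False by simp
        next
          case (block C' X P j' N')
          then have "X \<in> ?I" "j' = j - card X" using Some by auto
          then show ?thesis using block by blast
        qed
      qed
      have finI: "finite ?I" using fC by simp
      have Xfacts: "card X > 0 \<and> matching X \<and> card X \<le> j \<and> finite X" if "X \<in> ?I" for X
      proof -
        have "matching X" using that C matching_subset[of C X] by (auto simp: terms_over_def)
        then show ?thesis using that matching_finite[of X] by (simp add: card_gt_0_iff)
      qed
      have mTX: "matching (T - X)" for X using less.prems(1) matching_subset by blast
      have inner: "finite (?N X P) \<and> real (card (?N X P)) \<le> ?B ^ (j - card X)"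
        if X: "X \<in> ?I" and P: "P \<in> ?P X" for X P
      proof -
        have m: "matching (T - X \<union> P)" "(T - X) \<inter> P = {}" using P by (auto simp: cover_def)
        have "card (T - X \<union> P) \<ge> card (T - X)"
          using matching_finite[OF m(1)] by (intro card_mono) auto
        moreover have "card (T - X) \<ge> card T - card X" using Xfacts[OF X] by (intro diff_card_le_card_Diff) auto
        ultimately have "card R + (j - card X) \<le> l + card (T - X \<union> P)"
          using less.prems(2) Xfacts[OF X] by linarith
        then have *: "finite {N. decodes \<rho> ts (j - card X) (T - X \<union> P) N}"
          "real (card {N. decodes \<rho> ts (j - card X) (T - X \<union> P) N}) \<le> ?B ^ (j - card X)"
          using less.IH[of "j - card X" "T - X \<union> P"] m False Xfacts[OF X] by auto
        have "card (?N X P) \<le> card {N. decodes \<rho> ts (j - card X) (T - X \<union> P) N}"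
          by (rule card_image_le[OF *(1)])
        then show ?thesis using * by (meson finite_imageI of_nat_mono order_trans)
      qed
      have fW: "finite (\<Union>X)" if "X \<in> ?I" for X using finite_Union_matching Xfacts[OF that] by blast
      have mid: "finite (\<Union>P\<in>?P X. ?N X P) \<and> real (card (\<Union>P\<in>?P X. ?N X P)) \<le> ?B ^ j * (1 / (2 * real r)) ^ card X"
        if X: "X \<in> ?I" for X
      proof -
        note cov = card_cover[OF mTX fW[OF X], of X]
        have "Suc (card R) - card (T - X) \<le> l + 1"
        proof -
          have "card (T - X) \<ge> card T - card X" using Xfacts[OF X] by (intro diff_card_le_card_Diff) auto
          then show ?thesis using less.prems(2) Xfacts[OF X] by linarith
        qed
        then have "(Suc (card R) - card (T - X)) ^ card (\<Union>X) \<le> (l + 1) ^ card (\<Union>X)"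
          by (rule power_mono) simp
        also have "\<dots> \<le> (l + 1) ^ (2 * card X)"
          using card_Union_matching_le[of X] Xfacts[OF X] by (intro power_increasing) auto
        finally have "card (?P X) \<le> (l + 1) ^ (2 * card X)" using cov(2) by linarith
        then have cP: "real (card (?P X)) \<le> ?L ^ (2 * card X)" 
          by (metis of_nat_mono of_nat_power)
        have "card (\<Union>P\<in>?P X. ?N X P) \<le> (\<Sum>P\<in>?P X. card (?N X P))"
          by (rule card_UN_le[OF cov(1)])
        then have "real (card (\<Union>P\<in>?P X. ?N X P)) \<le> (\<Sum>P\<in>?P X. real (card (?N X P)))"
          unfolding of_nat_sum[symmetric] by (rule of_nat_mono)
        also have "\<dots> \<le> (\<Sum>P\<in>?P X. ?B ^ (j - card X))" using inner[OF X] by (intro sum_mono) auto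
        also have "\<dots> = real (card (?P X)) * ?B ^ (j - card X)" by simp
        also have "\<dots> \<le> ?L ^ (2 * card X) * ?B ^ (j - card X)"
          using cP B by (intro mult_right_mono) auto
        also have "\<dots> = ?B ^ j * (1 / (2 * real r)) ^ card X"
        proof -
          have b: "?B ^ j = ?B ^ card X * ?B ^ (j - card X)"
            using Xfacts[OF X] by (simp flip: power_add)
          have c: "?B ^ card X * (1 / (2 * real r)) ^ card X = ?L ^ (2 * card X)"
            using r by (simp add: power_mult_distrib power_divide flip: power_mult)
          show ?thesis unfolding b c[symmetric] by (simp only: mult_ac)
        qed
        finally show ?thesis using cov(1) inner[OF X] by simp
      qed
      have fin: "finite (\<Union>X\<in>?I. \<Union>P\<in>?P X. ?N X P)" using finI mid by blast
      have "card {N. decodes \<rho> ts j T N} \<le> card (\<Union>X\<in>?I. \<Union>P\<in>?P X. ?N X P)"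
        by (rule card_mono[OF fin sub])
      also have "\<dots> \<le> (\<Sum>X\<in>?I. card (\<Union>P\<in>?P X. ?N X P))" by (rule card_UN_le[OF finI])
      finally have "real (card {N. decodes \<rho> ts j T N}) \<le> (\<Sum>X\<in>?I. real (card (\<Union>P\<in>?P X. ?N X P)))"
        unfolding of_nat_sum[symmetric] by (rule of_nat_mono)
      also have "\<dots> \<le> (\<Sum>X\<in>?I. ?B ^ j * (1 / (2 * real r)) ^ card X)"
        using mid by (intro sum_mono) auto
      also have "\<dots> = ?B ^ j * (\<Sum>X\<in>?I. (1 / (2 * real r)) ^ card X)"
        by (simp add: sum_distrib_left)
      also have "\<dots> \<le> ?B ^ j * 1"
      proof (rule mult_left_mono)
        have "(\<Sum>X\<in>?I. (1 / (2 * real r)) ^ card X) \<le> (\<Sum>X\<in>Pow (C - \<rho>) - {{}}. (1 / (2 * real r)) ^ card X)"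
          using fC by (intro sum_mono2) auto
        also have "\<dots> = (1 + 1 / (2 * real r)) ^ card (C - \<rho>) - 1"
          using fC by (subst sum_diff1) (auto simp: sum_Pow_power_card)
        also have "\<dots> \<le> (1 + 1 / (2 * real r)) ^ r - 1"
          using cC by (intro diff_right_mono power_increasing) auto
        also have "(1 + 1 / (2 * real r)) ^ r \<le> exp (1 / (2 * real r)) ^ r"
          using exp_ge_add_one_self by (intro power_mono) auto
        also have "exp (1 / (2 * real r)) ^ r = exp (1 / 2)"
          using r by (simp flip: exp_of_nat_mult)
        also have "exp (1 / 2 :: real) \<le> 2" using exp_half_le2 by simp
        finally show "(\<Sum>X\<in>?I. (1 / (2 * real r)) ^ card X) \<le> 1" by simp
      qed (use B in simp)
      finally show ?thesis using finite_subset[OF sub fin] by simp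
    qed
  qed
qed

section \<open>Counting extensions and the switching lemma\<close>

definition extensions :: "'v set set \<Rightarrow> nat \<Rightarrow> 'v set set set" where
  "extensions \<rho> a = {M. matching M \<and> \<rho> \<subseteq> M \<and> card M = a}"

lemma finite_extensions: "finite (extensions \<rho> a)"
  by (rule finite_subset[OF _ finite_matchings]) (auto simp: extensions_def)

text \<open>Double counting of pairs of an extension and one of its edges outside
  \<open>\<rho>\<close>: deleting the edge leaves a smaller extension for which the edge is
  free.\<close>

lemma card_extensions_Suc:
  assumes "finite \<rho>"
  shows "card (extensions \<rho> (Suc a)) * (Suc a - card \<rho>) \<le> card (extensions \<rho> a) * (Suc (card R) - a) ^ 2"
proof -
  let ?f = "\<lambda>(M, e). (M - {e}, e)"
  let ?A = "Sigma (extensions \<rho> (Suc a)) (\<lambda>M. M - \<rho>)" and ?B = "Sigma (extensions \<rho> a) free_edges"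
  have "card ?A = (\<Sum>M\<in>extensions \<rho> (Suc a). card (M - \<rho>))"
    using matching_finite finite_extensions by (intro card_SigmaI) (auto simp: extensions_def)
  also have "\<dots> = (\<Sum>M\<in>extensions \<rho> (Suc a). Suc a - card \<rho>)"
    using assms by (intro sum.cong refl) (auto simp: extensions_def card_Diff_subset)
  finally have A: "card ?A = card (extensions \<rho> (Suc a)) * (Suc a - card \<rho>)" by simp
  have ff: "finite (free_edges M)" for M
    by (rule finite_subset[OF _ finite_edges]) (auto simp: free_edges_def)
  have "card ?B = (\<Sum>M\<in>extensions \<rho> a. card (free_edges M))"
    using finite_extensions ff by (intro card_SigmaI) auto
  also have "\<dots> \<le> (\<Sum>M\<in>extensions \<rho> a. (Suc (card R) - a) ^ 2)"
    using card_free_edges by (intro sum_mono) (auto simp: extensions_def power2_eq_square)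
  finally have B: "card ?B \<le> card (extensions \<rho> a) * (Suc (card R) - a) ^ 2" by simp
  have "inj_on ?f ?A" by (auto simp: inj_on_def)
  moreover have "?f ` ?A \<subseteq> ?B"
  proof (clarify)
    fix M e assume M: "M \<in> extensions \<rho> (Suc a)" "e \<in> M" "e \<notin> \<rho>"
    then have "matching M" "\<rho> \<subseteq> M" "card M = Suc a" by (auto simp: extensions_def)
    then show "M - {e} \<in> extensions \<rho> a \<and> e \<in> free_edges (M - {e})"
      using M matching_subset[of M "M - {e}"] matching_disjoint_rest[of M e "M - {e}"] matching_finite[of M]
      by (auto simp: extensions_def)
  qed
  moreover have "finite ?B" using finite_extensions ff by auto
  ultimately have "card ?A \<le> card ?B" by (rule card_inj_on_le)
  then show ?thesis using A B by linarith
qed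

lemma card_extensions_add:
  assumes "finite \<rho>" "card \<rho> \<le> a"
  shows "card (extensions \<rho> (a + j)) * (a - card \<rho>) ^ j \<le> card (extensions \<rho> a) * ((Suc (card R) - a) ^ 2) ^ j"
proof (induction j)
  case 0
  then show ?case by simp
next
  case (Suc j)
  let ?L = "(Suc (card R) - a) ^ 2"
  have "card (extensions \<rho> (a + Suc j)) * (a - card \<rho>) ^ Suc j
      \<le> card (extensions \<rho> (Suc (a + j))) * (Suc (a + j) - card \<rho>) * (a - card \<rho>) ^ j"
  proof -
    have "a - card \<rho> \<le> Suc (a + j) - card \<rho>" by linarith
    then show ?thesis by (simp add: mult.assoc mult_le_mono del: diff_Suc_Suc)
  qed
  also have "\<dots> \<le> card (extensions \<rho> (a + j)) * (Suc (card R) - (a + j)) ^ 2 * (a - card \<rho>) ^ j"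
    by (rule mult_le_mono1[OF card_extensions_Suc[OF assms(1)]])
  also have "\<dots> \<le> card (extensions \<rho> (a + j)) * ?L * (a - card \<rho>) ^ j"
    by (intro mult_le_mono1 mult_le_mono2 power_mono) auto
  also have "\<dots> = card (extensions \<rho> (a + j)) * (a - card \<rho>) ^ j * ?L" by simp
  also have "\<dots> \<le> card (extensions \<rho> a) * ?L ^ j * ?L" by (rule mult_le_mono1[OF Suc.IH])
  finally show ?case by (simp add: mult_ac)
qed

text \<open>Write \<open>q = a - card \<rho>\<close>. For encodings with \<open>j\<close> added
  edges, there are at most \<open>((l + 1)^2 / q)^j\<close> as many codes as extensions of size
  \<open>a\<close>, and each code has at most \<open>(2 * r * (l + 1)^2)^j\<close> decodings. The
  hypothesis on \<open>q\<close> makes the product at most \<open>16^-j\<close>. As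
  \<open>2 * j > s\<close>, this is at most \<open>2^-(s+1) * 4^-j\<close>, and the geometric series
  stays below 2.\<close>

theorem switching:
  assumes ts: "set ts \<subseteq> terms_over \<rho> r" and r: "r \<ge> 1" and \<rho>: "matching \<rho>"
    and al: "a + l = card R" and a: "card \<rho> \<le> a" and l: "s + 2 * r \<le> l"
    and q: "32 * r * (l + 1) ^ 4 \<le> a - card \<rho>"
  shows "2 ^ s * card {M \<in> extensions \<rho> a. \<not> decision_tree (decided (set ts)) s M} < card (extensions \<rho> a)"
proof -
  let ?L = "real (l + 1)" and ?q = "real (a - card \<rho>)" and ?N = "real (card (extensions \<rho> a))"
  let ?B = "2 * real r * ?L ^ 2"
  let ?J = "{j. s < 2 * j \<and> j \<le> l}"
  let ?deep = "{M \<in> extensions \<rho> a. \<not> decision_tree (decided (set ts)) s M}"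
  let ?dec = "\<lambda>j T. {N. decodes \<rho> ts j T N}"
  have "0 < 32 * r * (l + 1) ^ 4" using r by simp
  then have "0 < a - card \<rho>" using q by linarith
  then have qpos: "?q > 0" by simp
  have N: "?N > 0"
  proof -
    obtain M where "matching M" "\<rho> \<subseteq> M" "card M = a"
      using matching_extend_card[OF \<rho> a] al by auto
    then have "extensions \<rho> a \<noteq> {}" by (auto simp: extensions_def)
    then show ?thesis using finite_extensions[of \<rho> a] by (simp add: card_gt_0_iff)
  qed
  have finJ: "finite ?J" by simp
  have dec: "finite (?dec j T) \<and> real (card (?dec j T)) \<le> ?B ^ j" if "T \<in> extensions \<rho> (a + j)" for j T
    using card_decodes[OF ts r, of T j l] that al by (simp add: extensions_def)
  have sub: "?deep \<subseteq> (\<Union>j\<in>?J. \<Union>T\<in>extensions \<rho> (a + j). ?dec j T)"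
  proof
    fix M assume "M \<in> ?deep"
    then have M: "matching M" "\<rho> \<subseteq> M" "card M = a" "deep (decided (set ts)) (int s) M"
      by (auto simp: extensions_def deep_def)
    have "int (card M) + int s + 2 * int r \<le> int (card R)" using M al l by simp
    from deep_encoding[OF ts M(2,1,4) this] obtain X where X: "matching (M \<union> X)" "M \<inter> X = {}"
      "int s < 2 * int (card X)" "decodes \<rho> ts (card X) (M \<union> X) M" by blast
    have "finite M" "finite X" using matching_finite[OF X(1)] by auto
    then have cX: "card (M \<union> X) = a + card X" using X(2) M(3) by (simp add: card_Un_disjoint)
    moreover have "card (M \<union> X) \<le> card R" using card_freeR[OF X(1)] by simp
    ultimately have "card X \<in> ?J" using X(3) al by simp
    moreover have "M \<union> X \<in> extensions \<rho> (a + card X)" using X(1) M(2) cX by (auto simp: extensions_def)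
    ultimately show "M \<in> (\<Union>j\<in>?J. \<Union>T\<in>extensions \<rho> (a + j). ?dec j T)"
      using X(4) by blast
  qed
  have fin: "finite (\<Union>j\<in>?J. \<Union>T\<in>extensions \<rho> (a + j). ?dec j T)"
    using finJ finite_extensions dec by blast
  have each: "real (card (\<Union>T\<in>extensions \<rho> (a + j). ?dec j T)) \<le> ?N * (1 / 16) ^ j" for j
  proof -
    have "real (card (\<Union>T\<in>extensions \<rho> (a + j). ?dec j T))
        \<le> real (\<Sum>T\<in>extensions \<rho> (a + j). card (?dec j T))"
      by (intro of_nat_mono card_UN_le finite_extensions)
    also have "\<dots> = (\<Sum>T\<in>extensions \<rho> (a + j). real (card (?dec j T)))" by simp
    also have "\<dots> \<le> (\<Sum>T\<in>extensions \<rho> (a + j). ?B ^ j)" using dec by (intro sum_mono) auto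
    also have "\<dots> = real (card (extensions \<rho> (a + j))) * ?B ^ j" by simp
    finally have 1: "real (card (\<Union>T\<in>extensions \<rho> (a + j). ?dec j T))
      \<le> real (card (extensions \<rho> (a + j))) * ?B ^ j" .
    have L: "Suc (card R) - a = l + 1" using al by simp
    have "real (card (extensions \<rho> (a + j)) * (a - card \<rho>) ^ j) \<le> real (card (extensions \<rho> a) * ((l + 1)\<^sup>2) ^ j)"
      using card_extensions_add[OF matching_finite[OF \<rho>] a, of j] unfolding L by (rule of_nat_mono)
    then have "real (card (extensions \<rho> (a + j))) * ?q ^ j \<le> ?N * (?L ^ 2) ^ j"
      by (simp only: of_nat_mult of_nat_power)
    then have "real (card (extensions \<rho> (a + j))) * ?q ^ j * ?B ^ j \<le> ?N * (?L ^ 2) ^ j * ?B ^ j"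
      by (rule mult_right_mono) simp
    also have "\<dots> = ?N * (?L ^ 2 * ?B) ^ j" by (simp only: power_mult_distrib mult_ac)
    also have "\<dots> \<le> ?N * (?q / 16) ^ j"
    proof (intro mult_left_mono power_mono)
      have "real (32 * r * (l + 1) ^ 4) \<le> ?q" using q by (rule of_nat_mono)
      then have "32 * real r * ?L ^ 4 \<le> ?q" by (simp only: of_nat_mult of_nat_power of_nat_numeral)
      then have le: "2 * real r * ?L ^ 4 \<le> ?q / 16" by linarith
      have eq: "?L ^ 2 * ?B = 2 * real r * ?L ^ 4" by (simp add: power4_eq_xxxx power2_eq_square)
      show "?L ^ 2 * ?B \<le> ?q / 16" unfolding eq by (rule le)
    qed (use r N in auto)
    also have "\<dots> = ?N * (1 / 16) ^ j * ?q ^ j" by (simp add: power_divide)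
    finally have "real (card (extensions \<rho> (a + j))) * ?B ^ j * ?q ^ j \<le> ?N * (1 / 16) ^ j * ?q ^ j"
      by (simp only: mult_ac)
    then have "real (card (extensions \<rho> (a + j))) * ?B ^ j \<le> ?N * (1 / 16) ^ j"
      using qpos by (simp only: mult_le_cancel_right_pos zero_less_power)
    with 1 show ?thesis by linarith
  qed
  have "card ?deep \<le> card (\<Union>j\<in>?J. \<Union>T\<in>extensions \<rho> (a + j). ?dec j T)"
    by (rule card_mono[OF fin sub])
  also have "\<dots> \<le> (\<Sum>j\<in>?J. card (\<Union>T\<in>extensions \<rho> (a + j). ?dec j T))" by (rule card_UN_le[OF finJ])
  finally have "real (card ?deep) \<le> (\<Sum>j\<in>?J. real (card (\<Union>T\<in>extensions \<rho> (a + j). ?dec j T)))"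
    unfolding of_nat_sum[symmetric] by (rule of_nat_mono)
  also have "\<dots> \<le> (\<Sum>j\<in>?J. ?N * (1 / 2) ^ Suc s * (1 / 4) ^ j)"
  proof (rule sum_mono)
    fix j assume "j \<in> ?J"
    then have "(1 / 2 :: real) ^ (2 * j) \<le> (1 / 2) ^ Suc s" by (intro power_decreasing) auto
    moreover have "(1 / 16 :: real) ^ j = (1 / 2) ^ (2 * j) * (1 / 4) ^ j"
      by (simp add: power_mult power2_eq_square flip: power_mult_distrib)
    ultimately have "(1 / 16 :: real) ^ j \<le> (1 / 2) ^ Suc s * (1 / 4) ^ j"
      by (metis mult_right_mono zero_le_divide_1_iff zero_le_numeral zero_le_power)
    then have "?N * (1 / 16) ^ j \<le> ?N * ((1 / 2) ^ Suc s * (1 / 4) ^ j)" using N by (intro mult_left_mono) auto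
    then show "real (card (\<Union>T\<in>extensions \<rho> (a + j). ?dec j T)) \<le> ?N * (1 / 2) ^ Suc s * (1 / 4) ^ j"
      using each[of j] by (simp only: mult.assoc)
  qed
  also have "\<dots> = ?N * (1 / 2) ^ Suc s * (\<Sum>j\<in>?J. (1 / 4) ^ j)" by (simp add: sum_distrib_left)
  also have "\<dots> < ?N * (1 / 2) ^ Suc s * 2"
  proof (rule mult_strict_left_mono)
    have "(\<Sum>j\<in>?J. (1 / 4 :: real) ^ j) \<le> (\<Sum>j<Suc l. (1 / 4) ^ j)" by (intro sum_mono2) auto
    also have "\<dots> = (1 - (1 / 4) ^ Suc l) / (1 - 1 / 4)" by (subst sum_gp_strict) simp
    also have "\<dots> < 2" by (simp add: field_simps add_pos_pos)
    finally show "(\<Sum>j\<in>?J. (1 / 4 :: real) ^ j) < 2" .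
  qed (use N in simp)
  finally have "real (card ?deep) < ?N * (1 / 2) ^ s" by simp
  then have "2 ^ s * real (card ?deep) < 2 ^ s * (?N * (1 / 2) ^ s)" by (intro mult_strict_left_mono) auto
  also have "\<dots> = ?N" by (simp add: power_divide)
  finally have "real (2 ^ s * card ?deep) < real (card (extensions \<rho> a))" by simp
  then show ?thesis by (simp only: of_nat_less_iff)
qed

text \<open>A path of \<open>k\<close> queries adds at most \<open>k\<close> edges. The small leaves
  obtained here are the certificates that become terms in the next round.\<close>

lemma decision_tree_small:
  assumes "decision_tree S k M" "matching M"
  shows "decision_tree {N \<in> S. matching N \<and> M \<subseteq> N \<and> card N \<le> card M + k} k M"
  using assms
proof (induction rule: decision_tree.induct)
  case (leaf M k)
  then show ?case by (intro decision_tree.leaf) auto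
next
  case (query v M k)
  show ?case
  proof (rule decision_tree.query[OF query.hyps(1,2)])
    fix e assume e: "e \<in> free_edges M" "v \<in> e"
    have "matching (insert e M)" using matching_insert query.prems e by blast
    then have 1: "decision_tree {N \<in> S. matching N \<and> insert e M \<subseteq> N \<and> card N \<le> card (insert e M) + k} k (insert e M)"
      using query.IH[OF e] by blast
    have "card (insert e M) \<le> Suc (card M)" by (rule card_insert_le_m1) auto
    then show "decision_tree {N \<in> S. matching N \<and> M \<subseteq> N \<and> card N \<le> card M + Suc k} k (insert e M)"
      by (intro decision_tree_mono[OF 1 _ order_refl]) auto
  qed
qed

lemma matching_extend_cover:
  assumes "finite W" "W \<subseteq> D \<union> R" "matching M" "card M + card W \<le> card R"
  shows "\<exists>N. matching N \<and> M \<subseteq> N \<and> W \<subseteq> \<Union>N \<and> card N \<le> card M + card W"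
  using assms
proof (induction W arbitrary: M rule: finite_induct)
  case empty
  then show ?case by (intro exI[of _ M]) auto
next
  case (insert v W)
  have "\<exists>M'. matching M' \<and> M \<subseteq> M' \<and> v \<in> \<Union>M' \<and> card M' \<le> Suc (card M)"
  proof (cases "v \<in> \<Union>M")
    case True
    then show ?thesis using insert.prems by (intro exI[of _ M]) auto
  next
    case False
    then obtain e where e: "e \<in> free_edges M" "v \<in> e"
      using free_edge_exists[of M v] insert by auto
    have "card (insert e M) \<le> Suc (card M)" by (rule card_insert_le_m1) auto
    then show ?thesis using e matching_insert[OF insert.prems(2) e(1)]
      by (intro exI[of _ "insert e M"]) auto
  qed
  then obtain M' where M': "matching M'" "M \<subseteq> M'" "v \<in> \<Union>M'" "card M' \<le> Suc (card M)" by blast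
  have "W \<subseteq> D \<union> R" "card M' + card W \<le> card R" using M'(4) insert by auto
  then obtain N where "matching N" "M' \<subseteq> N" "W \<subseteq> \<Union>N" "card N \<le> card M' + card W"
    using insert.IH[OF _ M'(1)] by blast
  then show ?case using M' insert(1,2) by (intro exI[of _ N]) auto
qed

end

section \<open>Evaluating formulas by decision trees\<close>

text \<open>The recursion is the size condition of \<open>switching\<close> for terms and trees of size \<open>k\<close>.\<close>

fun holes_needed :: "nat \<Rightarrow> nat \<Rightarrow> nat" where
  "holes_needed k 0 = 10 * k"
| "holes_needed k (Suc n) = holes_needed k n + 32 * k * (holes_needed k n + 1) ^ 4"

text \<open>The base \<open>10 * k\<close> provides two margins: \<open>3 * k \<le> l\<close> for
  switching with \<open>r = s = k\<close>, and room in the soundness proof for a small matching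
  followed by two walks down trees, or by covering three vertices.\<close>

lemma holes_needed_ge: "10 * k \<le> holes_needed k n"
  by (induction n) auto

locale valued_bipartite = bipartite D R for D R :: "'v set" +
  fixes vertex :: "'a \<Rightarrow> 'v" and val :: "'a \<Rightarrow> 'v set \<Rightarrow> 'b"
  assumes vertex: "vertex x \<in> D \<union> R"
begin

definition atom_holds :: "bool \<Rightarrow> 'a \<times> 'b \<Rightarrow> 'v set set set" where
  "atom_holds b v = {M. matching M \<and> (\<exists>e\<in>M. vertex (fst v) \<in> e \<and> (val (fst v) e = snd v) = b)}"

text \<open>\<open>ev (b, c)\<close> is the set of matchings that decide \<open>c\<close> to have truth value \<open>b\<close>.  As in forcing, a false
  disjunction is only required to have no disjunct that becomes true under a larger matching.\<close>

definition evaluates :: "'v set set \<Rightarrow> nat \<Rightarrow> (('a \<times> 'b) nform \<Rightarrow> 'v set set set) \<Rightarrow> ('a \<times> 'b) core \<Rightarrow> bool" where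
  "evaluates \<rho> k ev c \<longleftrightarrow>
    (\<forall>b. up_closed (ev (b, c)) \<and> (\<forall>M\<in>ev (b, c). matching M) \<and>
      (\<forall>M\<in>ev (b, c). \<rho> \<subseteq> M \<longrightarrow> (\<exists>t\<in>ev (b, c). \<rho> \<subseteq> t \<and> t \<subseteq> M \<and> card t \<le> card \<rho> + k))) \<and>
    ev (True, c) \<inter> ev (False, c) = {} \<and>
    decision_tree (ev (True, c) \<union> ev (False, c)) k \<rho> \<and>
    (\<forall>v. c = Atom v \<longrightarrow> (\<forall>b. ev (b, c) = atom_holds b v)) \<and>
    (\<forall>S. c = Disj S \<longrightarrow> (\<forall>M\<in>ev (True, c). \<exists>x\<in>fset S. M \<in> ev x) \<and>
      (\<forall>M\<in>ev (False, c). \<forall>x\<in>fset S. \<forall>N. M \<subseteq> N \<longrightarrow> N \<notin> ev x))"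

lemma evaluates_up: "evaluates \<rho> k ev (snd x) \<Longrightarrow> up_closed (ev x)"
  and evaluates_matching: "evaluates \<rho> k ev (snd x) \<Longrightarrow> M \<in> ev x \<Longrightarrow> matching M"
  and evaluates_small: "evaluates \<rho> k ev (snd x) \<Longrightarrow> M \<in> ev x \<Longrightarrow> \<rho> \<subseteq> M \<Longrightarrow>
    \<exists>t\<in>ev x. \<rho> \<subseteq> t \<and> t \<subseteq> M \<and> card t \<le> card \<rho> + k"
  unfolding evaluates_def by (metis prod.collapse)+

lemma evaluates_disjoint: "evaluates \<rho> k ev (snd x) \<Longrightarrow> M \<in> ev x \<Longrightarrow> M \<notin> ev (neg x)"
  by (cases x; cases "fst x") (auto simp: evaluates_def)

lemma evaluates_decision_tree: "evaluates \<rho> k ev (snd x) \<Longrightarrow> decision_tree (ev x \<union> ev (neg x)) k \<rho>"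
  by (cases x; cases "fst x") (auto simp: evaluates_def Un_commute)

lemma evaluates_Disj_True: "evaluates \<rho> k ev (Disj S) \<Longrightarrow> M \<in> ev (True, Disj S) \<Longrightarrow> \<exists>x\<in>fset S. M \<in> ev x"
  and evaluates_Disj_False: "evaluates \<rho> k ev (Disj S) \<Longrightarrow> M \<in> ev (False, Disj S) \<Longrightarrow> x |\<in>| S \<Longrightarrow> M \<subseteq> N
    \<Longrightarrow> N \<notin> ev x"
  by (auto simp: evaluates_def)

lemma evaluates_cong:
  assumes "evaluates \<rho> k ev c" "\<And>b. ev' (b, c) = ev (b, c)" "\<And>S x. c = Disj S \<Longrightarrow> x |\<in>| S \<Longrightarrow> ev' x = ev x"
  shows "evaluates \<rho> k ev' c"
proof (cases c)
  case (Disj S)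
  then have "ev' x = ev x" if "x \<in> fset S" for x using assms(3) that by blast
  then have "\<forall>M\<in>ev (True, c). \<exists>x\<in>fset S. M \<in> ev' x"
    "\<forall>M\<in>ev (False, c). \<forall>x\<in>fset S. \<forall>N. M \<subseteq> N \<longrightarrow> N \<notin> ev' x"
    using assms(1) Disj unfolding evaluates_def by auto
  then show ?thesis using assms(1) Disj unfolding evaluates_def assms(2) by simp
next
  case (Atom v)
  then have "(c = Disj S) = False" for S by simp
  then show ?thesis using assms(1) unfolding evaluates_def assms(2) by simp
qed

text \<open>A certificate \<open>t\<close> over \<open>\<rho>\<close> becomes
  \<open>\<sigma> \<union> t\<close>, which again has at most \<open>k\<close> edges beyond the
  restriction.\<close>

lemma evaluates_restrict:
  assumes "evaluates \<rho> k ev c" "\<rho> \<subseteq> \<sigma>" "matching \<sigma>"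
  shows "evaluates \<sigma> k ev c"
proof -
  have "\<exists>t\<in>ev (b, c). \<sigma> \<subseteq> t \<and> t \<subseteq> M \<and> card t \<le> card \<sigma> + k" if M: "M \<in> ev (b, c)" "\<sigma> \<subseteq> M" for b M
  proof -
    have "evaluates \<rho> k ev (snd (b, c))" using assms(1) by simp
    note ev = evaluates_small[OF this M(1)] evaluates_up[OF this] evaluates_matching[OF this]
    obtain t where t: "t \<in> ev (b, c)" "\<rho> \<subseteq> t" "t \<subseteq> M" "card t \<le> card \<rho> + k"
      using ev(1)[OF subset_trans[OF assms(2) M(2)]] by blast
    have fin: "finite \<sigma>" "finite t" by (fact matching_finite[OF assms(3)], fact matching_finite[OF ev(3)[OF t(1)]])
    have "matching (\<sigma> \<union> t)" using matching_subset[OF ev(3)[OF M(1)]] M(2) t(3) by simp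
    then have "\<sigma> \<union> t \<in> ev (b, c)" using up_closedD[OF ev(2) t(1)] by simp
    moreover have "card (\<sigma> \<union> t) \<le> card \<sigma> + k"
    proof -
      have "card (t - \<rho>) \<le> k" using card_Diff_subset[OF finite_subset[OF t(2) fin(2)] t(2)] t(4) by simp
      moreover have "card (\<sigma> \<union> t) \<le> card \<sigma> + card (t - \<rho>)"
      proof -
        have "\<sigma> \<union> t = \<sigma> \<union> (t - \<rho>)" using assms(2) by blast
        then show ?thesis by (metis card_Un_le)
      qed
      ultimately show ?thesis by simp
    qed
    ultimately show ?thesis using M(2) t(3) by (intro bexI[of _ "\<sigma> \<union> t"]) auto
  qed
  moreover have "decision_tree (ev (True, c) \<union> ev (False, c)) k \<sigma>"
  proof (rule decision_tree_restrict[OF _ assms(2,3)])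
    show "up_closed (ev (True, c) \<union> ev (False, c))"
      using assms(1) unfolding evaluates_def up_closed_def by (metis Un_iff)
    show "decision_tree (ev (True, c) \<union> ev (False, c)) k \<rho>"
      using assms(1) by (simp add: evaluates_def)
  qed
  ultimately show ?thesis using assms(1) unfolding evaluates_def by simp
qed

lemma evaluates_atom:
  assumes "k \<ge> 1" "\<And>b. ev (b, Atom v) = atom_holds b v"
  shows "evaluates {} k ev (Atom v)"
proof -
  have up: "up_closed (atom_holds b v)" for b
    by (auto simp: up_closed_def atom_holds_def)
  have small: "\<exists>t\<in>atom_holds b v. t \<subseteq> M \<and> card t \<le> k" if M: "M \<in> atom_holds b v" for M b
  proof -
    obtain e where e: "e \<in> M" "vertex (fst v) \<in> e" "(val (fst v) e = snd v) = b" "matching M"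
      using M unfolding atom_holds_def by blast
    then have "{e} \<in> atom_holds b v" using matching_subset[of M "{e}"] by (auto simp: atom_holds_def)
    then show ?thesis using e assms(1) by (intro bexI[of _ "{e}"]) auto
  qed
  have disj: "atom_holds True v \<inter> atom_holds False v = {}"
    using matching_unique by (fastforce simp: atom_holds_def)
  have "decision_tree (atom_holds True v \<union> atom_holds False v) (Suc 0) {}"
  proof (rule decision_tree.query[OF vertex[of "fst v"]])
    fix e assume e: "e \<in> free_edges {}" "vertex (fst v) \<in> e"
    have "matching {e}" using matching_insert[OF matching_empty e(1)] by simp
    then have "{e} \<in> atom_holds True v \<union> atom_holds False v" using e by (auto simp: atom_holds_def)
    then show "decision_tree (atom_holds True v \<union> atom_holds False v) 0 (insert e {})" by (rule decision_tree.leaf)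
  qed simp
  then have decision_tree: "decision_tree (atom_holds True v \<union> atom_holds False v) k {}"
    by (rule decision_tree_mono) (use assms(1) in auto)
  have "\<forall>M\<in>atom_holds b v. matching M" for b by (simp add: atom_holds_def)
  then show ?thesis
    unfolding evaluates_def assms(2) using up small disj decision_tree assms(2) by simp
qed

definition evaluation :: "'v set set \<Rightarrow> nat \<Rightarrow> ('a \<times> 'b) core set \<Rightarrow> nat \<Rightarrow> (('a \<times> 'b) nform \<Rightarrow> 'v set set set) \<Rightarrow> bool" where
  "evaluation \<rho> k \<Gamma> n ev \<longleftrightarrow> (\<forall>c\<in>\<Gamma>. level_le n c \<longrightarrow> evaluates \<rho> k ev c)"

text \<open>The terms \<open>F c\<close> are the small certificates of the disjuncts of
  \<open>c\<close>, so switching applies with \<open>r = s = k\<close>. For each core it fails on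
  less than a \<open>2 ^ -k\<close> fraction of the extensions, and there are at most
  \<open>2 ^ k\<close> cores, so one extension serves all of them. Cores of lower level keep their
  evaluation by \<open>evaluates_restrict\<close>.\<close>

lemma evaluation_Suc:
  assumes ev: "evaluation \<rho> k \<Gamma> n ev" and \<rho>: "matching \<rho>" and k: "k \<ge> 1"
    and fin: "finite \<Gamma>" and card\<Gamma>: "card \<Gamma> \<le> 2 ^ k"
    and closed: "\<And>S x. Disj S \<in> \<Gamma> \<Longrightarrow> x |\<in>| S \<Longrightarrow> snd x \<in> \<Gamma>"
    and al: "a + l = card R" and a: "card \<rho> \<le> a" and l: "3 * k \<le> l"
    and q: "32 * k * (l + 1) ^ 4 \<le> a - card \<rho>"
  shows "\<exists>\<sigma> ev'. matching \<sigma> \<and> card \<sigma> = a \<and> evaluation \<sigma> k \<Gamma> (Suc n) ev'"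
proof -
  define F where "F c = {t \<in> terms_over \<rho> k. \<exists>S. c = Disj S \<and> (\<exists>x\<in>fset S. t \<in> ev x)}" for c
  let ?deep = "\<lambda>c. {M \<in> extensions \<rho> a. \<not> decision_tree (decided (F c)) k M}"
  have deep: "2 ^ k * card (?deep c) < card (extensions \<rho> a)" for c
  proof -
    have "finite (F c)" by (rule finite_subset[OF _ finite_matchings]) (auto simp: F_def terms_over_def)
    then obtain ts where ts: "set ts = F c" using finite_list by blast
    have "set ts \<subseteq> terms_over \<rho> k" using ts by (auto simp: F_def)
    from switching[OF this k \<rho> al a _ q, of k] show ?thesis using l ts by simp
  qed
  have "\<exists>\<sigma>\<in>extensions \<rho> a. \<forall>c\<in>\<Gamma>. decision_tree (decided (F c)) k \<sigma>"
  proof (cases "\<Gamma> = {}")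
    case True
    \<comment> \<open>The strict inequality, taken at any core whatever, shows that extensions
      exist.\<close>
    have "card (extensions \<rho> a) > 0" using deep[of undefined] by linarith
    then show ?thesis using True by (metis card_gt_0_iff empty_iff ex_in_conv)
  next
    case False
    have "2 ^ k * card (\<Union>c\<in>\<Gamma>. ?deep c) \<le> 2 ^ k * (\<Sum>c\<in>\<Gamma>. card (?deep c))"
      by (intro mult_le_mono2 card_UN_le fin)
    also have "\<dots> = (\<Sum>c\<in>\<Gamma>. 2 ^ k * card (?deep c))" by (simp add: sum_distrib_left)
    also have "\<dots> < (\<Sum>c\<in>\<Gamma>. card (extensions \<rho> a))" by (rule sum_strict_mono[OF fin False deep])
    also have "\<dots> = card \<Gamma> * card (extensions \<rho> a)" by simp
    also have "\<dots> \<le> 2 ^ k * card (extensions \<rho> a)" by (rule mult_le_mono1[OF card\<Gamma>])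
    finally have "card (\<Union>c\<in>\<Gamma>. ?deep c) < card (extensions \<rho> a)" by simp
    then have "\<not> extensions \<rho> a \<subseteq> (\<Union>c\<in>\<Gamma>. ?deep c)"
      using card_mono[of "\<Union>c\<in>\<Gamma>. ?deep c" "extensions \<rho> a"] fin finite_extensions by fastforce
    then show ?thesis by blast
  qed
  then obtain \<sigma> where \<sigma>: "\<rho> \<subseteq> \<sigma>" "matching \<sigma>" "card \<sigma> = a"
    and decision_tree\<sigma>: "\<And>c. c \<in> \<Gamma> \<Longrightarrow> decision_tree (decided (F c)) k \<sigma>" by (auto simp: extensions_def)
  define V where "V b S = {M. matching M \<and> (if b then \<exists>x\<in>fset S. M \<in> ev x
      else \<forall>x\<in>fset S. \<forall>N. M \<subseteq> N \<longrightarrow> N \<notin> ev x)}" for b S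
  \<comment> \<open>Keeping only matchings with a certificate of at most \<open>k\<close> edges
    beyond \<open>\<sigma>\<close> restores the condition on certificates from which the next round
    takes its terms.\<close>
  define small where "small U = {M. matching M \<and> (\<exists>t\<in>U. \<sigma> \<subseteq> t \<and> t \<subseteq> M \<and> card t \<le> card \<sigma> + k)}" for U
  define ev' where "ev' x = (if level_le n (snd x) then ev x else
      case snd x of Disj S \<Rightarrow> small (V (fst x) S) | Atom v \<Rightarrow> {})" for x
  have "evaluates \<sigma> k ev' c" if c: "c \<in> \<Gamma>" "level_le (Suc n) c" for c
  proof (cases "level_le n c")
    case True
    have same: "ev' (b, c) = ev (b, c)" for b using True by (simp add: ev'_def)
    have mem: "ev' x = ev x" if "c = Disj S" "x |\<in>| S" for S x
    proof -
      have "level_le (Suc n) (Disj S)" using c(2) that by simp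
      then show ?thesis using level_le_member[of n S x] that by (simp add: ev'_def)
    qed
    have "evaluates \<sigma> k ev c" using ev c(1) True \<sigma> evaluates_restrict by (auto simp: evaluation_def)
    then show ?thesis by (rule evaluates_cong) (use same mem in auto)
  next
    case False
    then obtain S where S: "c = Disj S" by (cases c) (auto intro: level_le.atom)
    have evS: "evaluates \<rho> k ev (snd x)" "ev' x = ev x" if "x |\<in>| S" for x
    proof -
      have "level_le n (snd x)" using level_le_member c(2) S that by blast
      then show "evaluates \<rho> k ev (snd x)" "ev' x = ev x"
        using ev closed[of S x] that c(1) S by (auto simp: evaluation_def ev'_def)
    qed
    have evc: "ev' (b, c) = small (V b S)" for b using False S by (simp add: ev'_def)
    have upV: "up_closed (V b S)" for b
      unfolding up_closed_def
    proof (intro ballI allI impI, elim conjE)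
      fix M N assume M: "M \<in> V b S" "M \<subseteq> N" "matching N"
      show "N \<in> V b S"
      proof (cases b)
        case True
        then obtain x where x: "x |\<in>| S" "M \<in> ev x" using M(1) by (auto simp: V_def)
        then have "N \<in> ev x" using up_closedD[OF evaluates_up[OF evS(1)] _ M(2,3)] by blast
        then show ?thesis using True x(1) M(3) by (auto simp: V_def)
      next
        case False
        have "\<forall>P. N \<subseteq> P \<longrightarrow> M \<subseteq> P" using M(2) by blast
        then show ?thesis using False M(1,3) unfolding V_def by simp
      qed
    qed
    have sub: "small (V b S) \<subseteq> V b S" for b
    proof
      fix M assume "M \<in> small (V b S)"
      then obtain t where "t \<in> V b S" "t \<subseteq> M" "matching M" by (auto simp: small_def)
      then show "M \<in> V b S" using up_closedD[OF upV] by blast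
    qed
    have disj: "V True S \<inter> V False S = {}" by (auto simp: V_def)
    have DTV: "decision_tree (V True S \<union> V False S) k \<sigma>"
    proof (rule decision_tree_mono[OF decision_tree\<sigma>[OF c(1)] _ order_refl])
      show "decided (F c) \<inter> {N. \<sigma> \<subseteq> N} \<subseteq> V True S \<union> V False S"
      proof
        fix M assume "M \<in> decided (F c) \<inter> {N. \<sigma> \<subseteq> N}"
        then have M: "matching M" "\<sigma> \<subseteq> M" and
          dec: "(\<exists>t\<in>F c. t \<subseteq> M) \<or> (\<forall>t\<in>F c. \<not> matching (t \<union> M))" by (auto simp: decided_def)
        show "M \<in> V True S \<union> V False S"
        proof (cases "\<exists>t\<in>F c. t \<subseteq> M")
          case True
          then obtain t x where t: "t \<subseteq> M" "x |\<in>| S" "t \<in> ev x" using S by (auto simp: F_def)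
          then have "M \<in> ev x" using evaluates_up[OF evS(1)[OF t(2)]] up_closedD M(1) by blast
          then show ?thesis using M(1) t(2) by (auto simp: V_def)
        next
          case False
          \<comment> \<open>Otherwise \<open>N\<close> would contain a certificate of
            \<open>x\<close> over \<open>\<rho>\<close>, a term of \<open>F c\<close> compatible
            with \<open>M\<close>; but \<open>M\<close> contradicts every term.\<close>
          have "N \<notin> ev x" if x: "x |\<in>| S" and N: "M \<subseteq> N" for x N
          proof
            assume Nx: "N \<in> ev x"
            have mN: "matching N" by (rule evaluates_matching[OF evS(1)[OF x] Nx])
            have "\<rho> \<subseteq> N" using \<sigma>(1) M(2) N by blast
            then obtain t where t: "t \<in> ev x" "\<rho> \<subseteq> t" "t \<subseteq> N" "card t \<le> card \<rho> + k"
              using evaluates_small[OF evS(1)[OF x] Nx] by blast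
            then have "t \<in> F c" using x S evaluates_matching[OF evS(1)[OF x] t(1)]
              by (auto simp: F_def terms_over_def)
            moreover have "matching (t \<union> M)" using matching_subset[OF mN] t(3) N by simp
            ultimately show False using dec False by blast
          qed
          then show ?thesis using M(1) by (auto simp: V_def)
        qed
      qed
    qed
    have "decision_tree (small (V True S) \<union> small (V False S)) k \<sigma>"
      by (rule decision_tree_mono[OF decision_tree_small[OF DTV \<sigma>(2)] _ order_refl]) (auto simp: small_def)
    moreover have "up_closed (small U)" for U
      unfolding up_closed_def small_def by blast
    moreover have "\<exists>t\<in>small (V b S). \<sigma> \<subseteq> t \<and> t \<subseteq> M \<and> card t \<le> card \<sigma> + k" if M: "M \<in> small (V b S)" for b M
    proof -
      obtain t where t: "t \<in> V b S" "\<sigma> \<subseteq> t" "t \<subseteq> M" "card t \<le> card \<sigma> + k"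
        using M by (auto simp: small_def)
      then have "t \<in> small (V b S)" by (auto simp: small_def V_def)
      then show ?thesis using t by blast
    qed
    moreover have "\<forall>M\<in>small (V b S). matching M" for b by (auto simp: small_def)
    moreover have "small (V True S) \<inter> small (V False S) = {}" using sub disj by blast
    moreover have "\<forall>M\<in>small (V True S). \<exists>x\<in>fset S. M \<in> ev' x"
    proof
      fix M assume "M \<in> small (V True S)"
      then obtain x where "x |\<in>| S" "M \<in> ev x" using sub[of True] by (auto simp: V_def)
      then show "\<exists>x\<in>fset S. M \<in> ev' x" using evS(2) by auto
    qed
    moreover have "\<forall>M\<in>small (V False S). \<forall>x\<in>fset S. \<forall>N. M \<subseteq> N \<longrightarrow> N \<notin> ev' x"
    proof (intro ballI allI impI)
      fix M x N assume "M \<in> small (V False S)" "x \<in> fset S" "M \<subseteq> N"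
      then show "N \<notin> ev' x" using sub[of False] evS(2) by (auto simp: V_def)
    qed
    ultimately show ?thesis unfolding evaluates_def evc using S by simp
  qed
  then have "evaluation \<sigma> k \<Gamma> (Suc n) ev'" by (simp add: evaluation_def)
  then show ?thesis using \<sigma> by blast
qed

text \<open>\<open>i\<close> counts the rounds still to come: reaching level \<open>n\<close> may
  use up all but \<open>holes_needed k i\<close> of the holes.\<close>

lemma evaluation_exists:
  assumes k: "k \<ge> 1" and fin: "finite \<Gamma>" and card\<Gamma>: "card \<Gamma> \<le> 2 ^ k"
    and closed: "\<And>S x. Disj S \<in> \<Gamma> \<Longrightarrow> x |\<in>| S \<Longrightarrow> snd x \<in> \<Gamma>"
    and h: "holes_needed k (i + n) \<le> card R"
  shows "\<exists>\<rho> ev. matching \<rho> \<and> card \<rho> + holes_needed k i \<le> card R \<and> evaluation \<rho> k \<Gamma> n ev"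
  using h
proof (induction n arbitrary: i)
  case 0
  have "evaluation {} k \<Gamma> 0 (\<lambda>x. case snd x of Atom v \<Rightarrow> atom_holds (fst x) v | _ \<Rightarrow> {})"
    unfolding evaluation_def using level_le_0 evaluates_atom[OF k] by fastforce
  then show ?case using 0 matching_empty by (intro exI[of _ "{}"]) auto
next
  case (Suc n)
  then have "holes_needed k (Suc i + n) \<le> card R" by simp
  from Suc.IH[OF this] obtain \<rho> ev where \<rho>: "matching \<rho>" "card \<rho> + holes_needed k (Suc i) \<le> card R"
    "evaluation \<rho> k \<Gamma> n ev" by blast
  let ?l = "holes_needed k i"
  let ?a = "card R - ?l"
  have f: "?a + ?l = card R" "card \<rho> \<le> ?a" "3 * k \<le> ?l" "32 * k * (?l + 1) ^ 4 \<le> ?a - card \<rho>"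
    using \<rho>(2) holes_needed_ge[of k i] by auto
  obtain \<sigma> ev' where "matching \<sigma>" "card \<sigma> = ?a" "evaluation \<sigma> k \<Gamma> (Suc n) ev'"
    using evaluation_Suc[OF \<rho>(3,1) k fin card\<Gamma> _ f] closed by blast
  then show ?case using f(1) by (intro exI[of _ \<sigma>] exI[of _ ev']) simp
qed

section \<open>Soundness\<close>

text \<open>Falsity in the sense of forcing. It is stated for a set of disjuncts, not through
  \<open>ev\<close> of the whole line, because the rules split and merge such sets.\<close>

definition refuted :: "(('a \<times> 'b) nform \<Rightarrow> 'v set set set) \<Rightarrow> 'v set set \<Rightarrow> ('a \<times> 'b) nform fset \<Rightarrow> bool" where
  "refuted ev M S \<longleftrightarrow> (\<forall>x\<in>fset S. \<forall>N. M \<subseteq> N \<longrightarrow> N \<notin> ev x)"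

lemma refuted_mono: "refuted ev M S \<Longrightarrow> M \<subseteq> N \<Longrightarrow> T |\<subseteq>| S \<Longrightarrow> refuted ev N T"
  unfolding refuted_def by (meson order_trans fsubsetD)

lemma refuted_union: "refuted ev M (S |\<union>| T) \<longleftrightarrow> refuted ev M S \<and> refuted ev M T"
  by (auto simp: refuted_def)

lemma refutedD: "refuted ev M S \<Longrightarrow> x |\<in>| S \<Longrightarrow> M \<subseteq> N \<Longrightarrow> N \<notin> ev x"
  by (auto simp: refuted_def)

lemma holds_disjunct:
  assumes "evaluates \<rho> k ev (snd x)" "M \<in> ev x"
  shows "\<exists>y. y |\<in>| disjuncts x \<and> M \<in> ev y"
proof (cases "\<exists>S. x = (True, Disj S)")
  case True
  then show ?thesis using assms evaluates_Disj_True by fastforce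
next
  case False
  then show ?thesis using assms disjuncts_other[of x] by (intro exI[of _ x]) simp
qed

lemma refuted_if_neg:
  assumes "evaluates \<rho> k ev (snd x)" "M \<in> ev (neg x)"
  shows "refuted ev M (disjuncts x)"
proof -
  have single: "refuted ev M {|x|}"
  proof -
    have "N \<notin> ev x" if "M \<subseteq> N" for N
    proof
      assume N: "N \<in> ev x"
      have "N \<in> ev (neg x)"
        using up_closedD[OF evaluates_up[of \<rho> k ev "neg x"] assms(2) that] assms(1)
          evaluates_matching[OF assms(1) N] by simp
      then show False using evaluates_disjoint[OF assms(1) N] by simp
    qed
    then show ?thesis by (simp add: refuted_def)
  qed
  show ?thesis
  proof (cases x rule: disjuncts.cases)
    case (1 S)
    then show ?thesis using assms evaluates_Disj_False by (auto simp: refuted_def)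
  qed (use single in auto)
qed

text \<open>If \<open>neg x\<close> is a disjunction, a matching satisfying \<open>x\<close> forbids
  each of its disjuncts, in particular \<open>y\<close>, which persists above \<open>M\<close>.
  Otherwise \<open>y\<close> is \<open>neg x\<close> itself. Needed for conjunctions, where only one
  negated conjunct is known to hold.\<close>

lemma refuted_if_neg_disjunct:
  assumes "evaluates \<rho> k ev (snd x)" "evaluates \<rho> k ev (snd y)" "y |\<in>| disjuncts (neg x)" "M \<in> ev y"
  shows "refuted ev M (disjuncts x)"
proof (cases "\<exists>S. neg x = (True, Disj S)")
  case True
  then obtain S where S: "x = (False, Disj S)" by (cases x) auto
  have "N \<notin> ev x" if "M \<subseteq> N" for N
  proof
    assume N: "N \<in> ev x"
    have "N \<in> ev y"
      using up_closedD[OF evaluates_up[OF assms(2)] assms(4) that] evaluates_matching[OF assms(1) N] by simp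
    moreover have "N \<notin> ev y"
      using evaluates_Disj_False[of \<rho> k ev S N y N] assms(1,3) N S by simp
    ultimately show False by simp
  qed
  then show ?thesis using S by (simp add: refuted_def)
next
  case False
  then have "y = neg x" using disjuncts_other[of "neg x"] assms(3) by simp
  then show ?thesis using refuted_if_neg[OF assms(1)] assms(4) by simp
qed

lemma evaluates_walk:
  assumes "evaluates \<rho> k ev (snd x)" "matching M" "\<rho> \<subseteq> M" "card M + k \<le> card R"
  shows "\<exists>N t. matching N \<and> M \<subseteq> N \<and> card N \<le> card M + k \<and> \<rho> \<subseteq> t \<and> t \<subseteq> N \<and> card t \<le> card \<rho> + k \<and>
    (t \<in> ev x \<or> t \<in> ev (neg x))"
  using decision_tree_walk[OF evaluates_decision_tree[OF assms(1)] assms(3,2,4)] by (metis Un_iff)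

lemma evaluates_decide:
  assumes "evaluates \<rho> k ev (snd x)" "matching M" "\<rho> \<subseteq> M" "card M + k \<le> card R"
  shows "\<exists>N. matching N \<and> M \<subseteq> N \<and> card N \<le> card M + k \<and> (N \<in> ev x \<or> N \<in> ev (neg x))"
proof -
  obtain N t where *: "matching N" "M \<subseteq> N" "card N \<le> card M + k" "t \<subseteq> N" "t \<in> ev x \<or> t \<in> ev (neg x)"
    using evaluates_walk[OF assms] by blast
  have "up_closed (ev x)" "up_closed (ev (neg x))"
    using evaluates_up[of \<rho> k ev] assms(1) by auto
  then show ?thesis using * up_closedD by blast
qed

lemma not_refuted_both:
  assumes "evaluates \<rho> k ev (snd x)" "matching M" "\<rho> \<subseteq> M" "card M + k \<le> card R"
  shows "\<not> (refuted ev M (disjuncts x) \<and> refuted ev M (disjuncts (neg x)))"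
proof -
  obtain N where N: "M \<subseteq> N" "N \<in> ev x \<or> N \<in> ev (neg x)"
    using evaluates_decide[OF assms] by blast
  from N(2) show ?thesis
  proof
    assume "N \<in> ev x"
    from holds_disjunct[OF assms(1) this] show ?thesis using N(1) refutedD by blast
  next
    assume "N \<in> ev (neg x)"
    with holds_disjunct[of \<rho> k ev "neg x" N] assms(1) obtain y where "y |\<in>| disjuncts (neg x)" "N \<in> ev y"
      by auto
    then show ?thesis using N(1) refutedD by blast
  qed
qed

text \<open>The bound on \<open>M\<close> is the same for every line, so nothing accumulates along a
  refutation: \<open>valid_extend\<close> passes from small matchings to all those with
  \<open>k\<close> holes to spare.\<close>

definition valid :: "'v set set \<Rightarrow> nat \<Rightarrow> (('a \<times> 'b) nform \<Rightarrow> 'v set set set) \<Rightarrow> ('a \<times> 'b) nform \<Rightarrow> bool" where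
  "valid \<rho> k ev x \<longleftrightarrow> (\<forall>M. matching M \<and> \<rho> \<subseteq> M \<and> card M \<le> card \<rho> + k \<longrightarrow> \<not> refuted ev M (disjuncts x))"

text \<open>A walk through the tree of the line ends in a leaf \<open>t\<close> with at most
  \<open>k\<close> edges beyond \<open>\<rho>\<close>. If \<open>t\<close> makes the line true, an
  extension of \<open>M\<close> satisfies a disjunct; if \<open>t\<close> makes it false,
  \<open>t\<close> is itself a small matching refuting the line.\<close>

lemma valid_extend:
  assumes "evaluates \<rho> k ev (snd x)" "valid \<rho> k ev x" "matching M" "\<rho> \<subseteq> M" "card M + k \<le> card R"
  shows "\<not> refuted ev M (disjuncts x)"
proof
  assume ref: "refuted ev M (disjuncts x)"
  obtain N t where *: "matching N" "M \<subseteq> N" "\<rho> \<subseteq> t" "t \<subseteq> N" "card t \<le> card \<rho> + k" "t \<in> ev x \<or> t \<in> ev (neg x)"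
    using evaluates_walk[OF assms(1,3-5)] by blast
  show False
  proof (cases "t \<in> ev x")
    case True
    then have "N \<in> ev x" using up_closedD[OF evaluates_up[OF assms(1)]] * by blast
    then obtain y where "y |\<in>| disjuncts x" "N \<in> ev y" using holds_disjunct[OF assms(1)] by blast
    then show False using refutedD[OF ref] *(2) by blast
  next
    case False
    then have "refuted ev t (disjuncts x)" using refuted_if_neg[OF assms(1)] * by blast
    moreover have "matching t" using matching_subset * by blast
    ultimately show False using assms(2) * by (simp add: valid_def)
  qed
qed

definition lit_holds :: "('a \<times> 'b) literal \<Rightarrow> 'v set set set" where
  "lit_holds l = (case l of Pos v \<Rightarrow> atom_holds True v | Neg v \<Rightarrow> atom_holds False v)"

definition locally_satisfied :: "('a \<times> 'b) clause set \<Rightarrow> bool" where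
  "locally_satisfied H \<longleftrightarrow> (\<forall>C\<in>H. \<exists>W\<subseteq>D \<union> R. card W \<le> 3 \<and>
    (\<forall>M. matching M \<and> W \<subseteq> \<Union>M \<longrightarrow> (\<exists>l\<in>C. M \<in> lit_holds l)))"

text \<open>For cut and conjunction introduction, a matching refuting the conclusion is extended
  until it decides the cut formula or the conjunction; it then refutes a premise. A hypothesis is
  settled by covering the at most three vertices belonging to its clause.\<close>

lemma frege_step_valid:
  assumes step: "frege_step H L F" and H: "locally_satisfied H"
    and ev: "\<And>c. c \<in> \<Gamma> \<Longrightarrow> evaluates \<rho> k ev c"
    and closed: "\<And>S x. Disj S \<in> \<Gamma> \<Longrightarrow> x |\<in>| S \<Longrightarrow> snd x \<in> \<Gamma>"
    and size: "card \<rho> + 10 * k \<le> card R" "k \<ge> 1"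
    and F: "snd (nf F) \<in> \<Gamma>" and L: "\<And>P. P \<in> L \<Longrightarrow> snd (nf P) \<in> \<Gamma> \<and> valid \<rho> k ev (nf P)"
  shows "valid \<rho> k ev (nf F)"
  unfolding valid_def
proof (intro allI impI notI, elim conjE)
  fix M assume M: "matching M" "\<rho> \<subseteq> M" "card M \<le> card \<rho> + k" and ref: "refuted ev M (disjuncts (nf F))"
  have closed': "snd y \<in> \<Gamma>" if "snd x \<in> \<Gamma>" "y |\<in>| disjuncts x" for x y
    using that closed by (cases x rule: disjuncts.cases) auto
  \<comment> \<open>A cut formula that is a disjunction dissolves into the disjuncts of its premise,
    but its negation then survives as one disjunct of the other premise. So its core always lies in
    \<open>\<Gamma>\<close>.\<close>
  have self: "x |\<in>| disjuncts x \<or> neg x |\<in>| disjuncts (neg x)" for x :: "('a \<times> 'b) nform"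
    by (cases x rule: disjuncts.cases) auto
  have in\<Gamma>: "snd a \<in> \<Gamma>" if "disjuncts a |\<subseteq>| disjuncts x" "disjuncts (neg a) |\<subseteq>| disjuncts y"
    "snd x \<in> \<Gamma>" "snd y \<in> \<Gamma>" for a x y
    using self[of a] closed'[OF that(3), of a] closed'[OF that(4), of "neg a"] that(1,2)
    by (metis fsubsetD snd_neg)
  have L': False if "P \<in> L" "refuted ev N (disjuncts (nf P))" "matching N" "M \<subseteq> N" "card N \<le> card M + k" for P N
  proof -
    have "\<rho> \<subseteq> N" "card N + k \<le> card R" using that M size by auto
    then show False using valid_extend[OF ev, of "nf P" N] L[OF that(1)] that by blast
  qed
  have Mk: "card M + k \<le> card R" using M(3) size by simp
  show False
    using step
  proof cases
    case hypothesis
    then obtain W where W: "W \<subseteq> D \<union> R" "card W \<le> 3"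
      "\<And>N. matching N \<Longrightarrow> W \<subseteq> \<Union>N \<Longrightarrow> \<exists>l\<in>literals F. N \<in> lit_holds l"
      using H unfolding locally_satisfied_def by meson
    have finW: "finite W" using W(1) finD finR finite_subset by blast
    have "card M + card W \<le> card R" using M(3) W(2) size by simp
    then obtain N where N: "matching N" "M \<subseteq> N" "W \<subseteq> \<Union>N"
      using matching_extend_cover[OF finW W(1) M(1)] by blast
    obtain l where l: "l \<in> literals F" "N \<in> lit_holds l" using W(3) N by blast
    have mem: "nlit l |\<in>| disjuncts (nf F)" using disjuncts_clause[OF hypothesis(1)] l(1) by blast
    have "evaluates \<rho> k ev (snd (nlit l))" using ev closed'[OF F mem] by blast
    then have "ev (nlit l) = lit_holds l"
      by (cases l) (auto simp: evaluates_def lit_holds_def)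
    then show False using refutedD[OF ref mem N(2)] l(2) by simp
  next
    case (excluded_middle A)
    let ?a = "nf A"
    have eq: "disjuncts (nf F) = disjuncts ?a |\<union>| disjuncts (neg ?a)"
      using disjuncts_aci_Or[OF excluded_middle] by (simp only: nf_complement)
    have "snd ?a \<in> \<Gamma>" by (rule in\<Gamma>[OF _ _ F F]) (simp_all add: eq)
    then show False using not_refuted_both[OF ev M(1,2) Mk] ref unfolding eq refuted_union by blast
  next
    case (cut P Q C A D)
    let ?a = "nf A"
    have P: "disjuncts (nf P) = disjuncts (nf C) |\<union>| disjuncts ?a"
      and Q: "disjuncts (nf Q) = disjuncts (nf D) |\<union>| disjuncts (neg ?a)"
      and FF: "disjuncts (nf F) = disjuncts (nf C) |\<union>| disjuncts (nf D)"
      using disjuncts_aci_Or cut(3-5) nf_complement by metis+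
    have "snd ?a \<in> \<Gamma>" by (rule in\<Gamma>[of _ "nf P" "nf Q"]) (use P Q L cut in auto)
    note ea = ev[OF this]
    obtain N where N: "matching N" "M \<subseteq> N" "card N \<le> card M + k" "N \<in> ev ?a \<or> N \<in> ev (neg ?a)"
      using evaluates_decide[OF ea M(1,2) Mk] by blast
    have refN: "refuted ev N (disjuncts (nf C))" "refuted ev N (disjuncts (nf D))"
      using ref refuted_mono[OF _ N(2)] unfolding FF refuted_union by blast+
    show False
    proof (cases "N \<in> ev ?a")
      case True
      then have "refuted ev N (disjuncts (neg ?a))" using refuted_if_neg[of \<rho> k ev "neg ?a" N] ea by simp
      then show False using L'[OF cut(2) _ N(1-3)] refN Q by (simp add: refuted_union)
    next
      case False
      then have "refuted ev N (disjuncts ?a)" using refuted_if_neg[OF ea] N(4) by blast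
      then show False using L'[OF cut(1) _ N(1-3)] refN P by (simp add: refuted_union)
    qed
  next
    case (and_intro P Q C A D B)
    let ?a = "nf A" and ?b = "nf B" and ?n = "nf (And A B)"
    have P: "disjuncts (nf P) = disjuncts (nf C) |\<union>| disjuncts ?a"
      and Q: "disjuncts (nf Q) = disjuncts (nf D) |\<union>| disjuncts ?b"
      and FF: "disjuncts (nf F) = disjuncts (nf C) |\<union>| disjuncts (nf D) |\<union>| disjuncts ?n"
      using disjuncts_aci_Or and_intro(3-5) disjuncts_nf_Or by metis+
    have Y: "disjuncts (neg ?n) = disjuncts (neg ?a) |\<union>| disjuncts (neg ?b)"
      by (rule disjuncts_nf_And)
    have refM: "refuted ev M (disjuncts (nf C))" "refuted ev M (disjuncts (nf D))" "refuted ev M (disjuncts ?n)"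
      using ref unfolding FF refuted_union by auto
    have conjunct: False if line: "U \<in> L" "disjuncts (nf U) = disjuncts (nf X) |\<union>| disjuncts a"
        "refuted ev M (disjuncts (nf X))"
      and a: "disjuncts (neg a) |\<subseteq>| disjuncts (neg ?n)"
      and y: "y |\<in>| disjuncts (neg a)" "N \<in> ev y" and n: "snd ?n \<in> \<Gamma>"
      and N: "matching N" "M \<subseteq> N" "card N \<le> card M + k" for U X a y N
    proof -
      have "snd a \<in> \<Gamma>" using line(2) L[OF line(1)] a n by (intro in\<Gamma>[of a "nf U" "neg ?n"]) auto
      note ea = ev[OF this]
      have "y |\<in>| disjuncts (neg ?n)" using y(1) a by (rule fsubsetD[rotated])
      then have "snd y \<in> \<Gamma>" using closed'[of "neg ?n" y] n by simp
      then have "refuted ev N (disjuncts a)" using refuted_if_neg_disjunct[OF ea ev y] by blast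
      moreover have "refuted ev N (disjuncts (nf X))" by (rule refuted_mono[OF line(3) N(2)]) simp
      ultimately show False using L'[OF line(1) _ N] line(2) by (simp add: refuted_union)
    qed
    show False
    proof (cases "?n |\<in>| disjuncts ?n")
      case True
      then have n: "snd ?n \<in> \<Gamma>" using closed'[OF F, of ?n] FF by simp
      obtain N where N: "matching N" "M \<subseteq> N" "card N \<le> card M + k" "N \<in> ev ?n \<or> N \<in> ev (neg ?n)"
        using evaluates_decide[OF ev[OF n] M(1,2) Mk] by blast
      have "N \<notin> ev ?n" using holds_disjunct[OF ev[OF n]] refutedD[OF refM(3) _ N(2)] by blast
      then have neg: "N \<in> ev (neg ?n)" using N(4) by blast
      have "evaluates \<rho> k ev (snd (neg ?n))" using ev[OF n] by simp
      then obtain y where y: "y |\<in>| disjuncts (neg ?n)" "N \<in> ev y" using holds_disjunct neg by blast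
      then consider "y |\<in>| disjuncts (neg ?a)" | "y |\<in>| disjuncts (neg ?b)" using Y by auto
      then show False
      proof cases
        case 1
        show False
          by (rule conjunct[OF and_intro(1) P refM(1) _ 1 y(2) n N(1-3)]) (simp only: Y sup_ge1)
      next
        case 2
        show False
          by (rule conjunct[OF and_intro(2) Q refM(2) _ 2 y(2) n N(1-3)]) (simp only: Y sup_ge2)
      qed
    next
      \<comment> \<open>By idempotence or unit the conjunction may normalise to a disjunction. Its
        negation is then a single disjunct, so one of \<open>A\<close> and \<open>B\<close> has the
        same normal form as the conjunction, and \<open>M\<close> already refutes a premise.\<close>
      case False
      then have "\<exists>S. ?n = (True, Disj S)" using disjuncts_other[of ?n] by (metis finsertI1)
      then have "disjuncts (neg ?n) = {|neg ?n|}" by (rule disjuncts_neg_Disj)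
      then have "disjuncts (neg ?a) |\<union>| disjuncts (neg ?b) = {|neg ?n|}" using Y by simp
      then have "disjuncts (neg ?a) = {|neg ?n|} \<or> disjuncts (neg ?b) = {|neg ?n|}"
        by (metis funion_fempty_left fsubset_fsingletonD sup_ge1)
      then have "neg ?a = neg ?n \<or> neg ?b = neg ?n"
        using canonical_disjuncts(3) canonical_nf canonical_neg by metis
      then have "?a = ?n \<or> ?b = ?n" by (metis neg_neg)
      then show False
      proof
        assume "?a = ?n"
        then have "disjuncts (nf P) = disjuncts (nf C) |\<union>| disjuncts ?n" using P by simp
        then show False using L'[OF and_intro(1) _ M(1)] refM(1,3) by (simp add: refuted_union)
      next
        assume "?b = ?n"
        then have "disjuncts (nf Q) = disjuncts (nf D) |\<union>| disjuncts ?n" using Q by simp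
        then show False using L'[OF and_intro(2) _ M(1)] refM(2,3) by (simp add: refuted_union)
      qed
    qed
  next
    case (weakening C D)
    then have "disjuncts (nf C) |\<subseteq>| disjuncts (nf F)" using disjuncts_aci_Or by fastforce
    then have "refuted ev M (disjuncts (nf C))" using ref refuted_mono by blast
    then show False using L'[OF weakening(1) _ M(1)] by simp
  qed
qed

text \<open>A refutation of size at most \<open>2 ^ k\<close> has at most \<open>2 ^ k\<close>
  cores, so a single evaluation covers every subformula of every line. \<open>Suc (nat d)\<close>
  rounds reach the level given by \<open>level_le_Sigma_Pi\<close>.\<close>

theorem refutation_size_lower_bound:
  assumes H: "locally_satisfied H" and ref: "frege_refutation H \<pi>" and depth: "has_depth d \<pi>"
    and k: "k \<ge> 1" and h: "holes_needed k (Suc (nat d)) \<le> card R"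
  shows "2 ^ k < refutation_size \<pi>"
proof (rule ccontr)
  assume "\<not> 2 ^ k < refutation_size \<pi>"
  then have small: "refutation_size \<pi> \<le> 2 ^ k" by simp
  define \<Gamma> where "\<Gamma> = (\<Union>F\<in>set \<pi>. subcores (snd (nf F)))"
  have fin: "finite \<Gamma>" using card_subcores_nf by (auto simp: \<Gamma>_def)
  have "card \<Gamma> \<le> (\<Sum>F\<in>set \<pi>. card (subcores (snd (nf F))))"
    unfolding \<Gamma>_def by (rule card_UN_le) simp
  also have "\<dots> \<le> (\<Sum>F\<in>set \<pi>. form_size F)" using card_subcores_nf by (intro sum_mono) auto
  also have "\<dots> \<le> refutation_size \<pi>" unfolding refutation_size_def
    by (induction \<pi>) (auto simp: sum.insert_if)
  finally have card\<Gamma>: "card \<Gamma> \<le> 2 ^ k" using small by simp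
  have closed: "snd x \<in> \<Gamma>" if "Disj S \<in> \<Gamma>" "x |\<in>| S" for S x
    using that subcores_closed unfolding \<Gamma>_def by fast
  have "holes_needed k (0 + Suc (nat d)) \<le> card R" using h by simp
  from evaluation_exists[OF k fin card\<Gamma> _ this] closed obtain \<rho> ev where \<rho>: "matching \<rho>"
    "card \<rho> + holes_needed k 0 \<le> card R" "evaluation \<rho> k \<Gamma> (Suc (nat d)) ev" by blast
  have ev: "evaluates \<rho> k ev c" if "c \<in> \<Gamma>" for c
  proof -
    obtain F where "F \<in> set \<pi>" "c \<in> subcores (snd (nf F))" using \<open>c \<in> \<Gamma>\<close> by (auto simp: \<Gamma>_def)
    then have "level_le (Suc (nat d)) c"
      using level_le_subcores level_le_Sigma_Pi(1) depth unfolding has_depth_def by blast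
    then show ?thesis using \<rho>(3) that by (simp add: evaluation_def)
  qed
  have line\<Gamma>: "snd (nf F) \<in> \<Gamma>" if "F \<in> set \<pi>" for F using that subcores_refl by (auto simp: \<Gamma>_def)
  have size: "card \<rho> + 10 * k \<le> card R" using \<rho>(2) by simp
  have "valid \<rho> k ev (nf (\<pi> ! i))" if "i < length \<pi>" for i
    using that
  proof (induction i rule: less_induct)
    case (less i)
    have step: "frege_step H (set (take i \<pi>)) (\<pi> ! i)" using ref less.prems by (simp add: frege_refutation_def)
    show ?case
    proof (rule frege_step_valid[OF step H ev closed size k])
      show "snd (nf (\<pi> ! i)) \<in> \<Gamma>" using line\<Gamma> less.prems by simp
      fix P assume "P \<in> set (take i \<pi>)"
      then obtain j where "j < i" "P = \<pi> ! j" using less.prems by (auto simp: in_set_conv_nth)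
      then show "snd (nf P) \<in> \<Gamma> \<and> valid \<rho> k ev (nf P)" using less line\<Gamma> by simp
    qed
  qed
  moreover have "length \<pi> - 1 < length \<pi>" "\<pi> ! (length \<pi> - 1) = Bot"
    using ref last_conv_nth[of \<pi>] by (auto simp: frege_refutation_def)
  ultimately have "valid \<rho> k ev (nf Bot)" by metis
  then show False using \<rho>(1) by (auto simp: valid_def refuted_def)
qed

end

section \<open>The pigeonhole system of equations\<close>

text \<open>\<open>Xv i j\<close> is the unknown of pigeon \<open>i\<close> and hole
  \<open>j\<close>; \<open>Yv i j\<close> is the product of the first \<open>j\<close> unknowns of
  row \<open>i\<close>, and \<open>Zv j i\<close> that of the first \<open>i\<close> unknowns of
  column \<open>j\<close>.\<close>

definition Xv :: "nat \<Rightarrow> nat \<Rightarrow> nat" where "Xv i j = prod_encode (0, prod_encode (i, j))"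
definition Yv :: "nat \<Rightarrow> nat \<Rightarrow> nat" where "Yv i j = prod_encode (1, prod_encode (i, j))"
definition Zv :: "nat \<Rightarrow> nat \<Rightarrow> nat" where "Zv j i = prod_encode (2, prod_encode (j, i))"

lemmas var_defs = Xv_def Yv_def Zv_def

definition php_vars :: "nat \<Rightarrow> nat set" where
  "php_vars m = {Xv i j | i j. i \<le> m \<and> j < m} \<union> {Yv i j | i j. i \<le> m \<and> j \<le> m}
     \<union> {Zv j i | i j. j < m \<and> i \<le> Suc m}"

definition step_eqs :: "nat \<Rightarrow> nat list set" where
  "step_eqs m = {[Yv i (Suc j), Yv i j, Xv i j] | i j. i \<le> m \<and> j < m}
     \<union> {[Zv j (Suc i), Zv j i, Xv i j] | i j. i \<le> m \<and> j < m}"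

text \<open>Relations are ternary, so a condition on a single unknown repeats it and takes the
  coefficients 1, 0, 0.\<close>

definition start_eqs :: "nat \<Rightarrow> nat list set" where
  "start_eqs m = {[Yv i 0, Yv i 0, Yv i 0] | i. i \<le> m} \<union> {[Zv j 0, Zv j 0, Zv j 0] | j. j < m}"

definition end_eqs :: "nat \<Rightarrow> nat list set" where
  "end_eqs m = {[Yv i m, Yv i m, Yv i m] | i. i \<le> m}
     \<union> {[Zv j (Suc m), Zv j (Suc m), Zv j (Suc m)] | j. j < m}"

text \<open>Symbols are relations and may coincide, for instance when \<open>g\<close> is the unit;
  the disjunction collects the equations in every case.\<close>

definition php_system :: "('g, 'm) monoid_scheme \<Rightarrow> 'g \<Rightarrow> nat \<Rightarrow> ('g list set, nat) rel_struct" where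
  "php_system G g m = \<lparr>universe = php_vars m,
     interp = (\<lambda>R. {as. R = lin_rel G 1 (-1) (-1) \<one>\<^bsub>G\<^esub> \<and> as \<in> step_eqs m \<or>
       R = lin_rel G 1 0 0 \<one>\<^bsub>G\<^esub> \<and> as \<in> start_eqs m \<or> R = lin_rel G 1 0 0 g \<and> as \<in> end_eqs m})\<rparr>"

lemma php_vars_image:
  "php_vars m = (\<lambda>(i, j). Xv i j) ` ({..m} \<times> {..<m}) \<union> (\<lambda>(i, j). Yv i j) ` ({..m} \<times> {..m})
    \<union> (\<lambda>(j, i). Zv j i) ` ({..<m} \<times> {..Suc m})"
  unfolding php_vars_def by auto

lemma finite_php_vars: "finite (php_vars m)"
  unfolding php_vars_image by simp

lemma step_eqs_image:
  "step_eqs m = (\<lambda>(i, j). [Yv i (Suc j), Yv i j, Xv i j]) ` ({..m} \<times> {..<m})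
    \<union> (\<lambda>(i, j). [Zv j (Suc i), Zv j i, Xv i j]) ` ({..m} \<times> {..<m})"
  unfolding step_eqs_def by auto

lemma start_eqs_image:
  "start_eqs m = (\<lambda>i. [Yv i 0, Yv i 0, Yv i 0]) ` {..m} \<union> (\<lambda>j. [Zv j 0, Zv j 0, Zv j 0]) ` {..<m}"
  unfolding start_eqs_def by auto

lemma end_eqs_image:
  "end_eqs m = (\<lambda>i. [Yv i m, Yv i m, Yv i m]) ` {..m}
    \<union> (\<lambda>j. [Zv j (Suc m), Zv j (Suc m), Zv j (Suc m)]) ` {..<m}"
  unfolding end_eqs_def by auto

lemma php_varsI:
  "i \<le> m \<Longrightarrow> j < m \<Longrightarrow> Xv i j \<in> php_vars m"
  "i \<le> m \<Longrightarrow> j \<le> m \<Longrightarrow> Yv i j \<in> php_vars m"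
  "i \<le> Suc m \<Longrightarrow> j < m \<Longrightarrow> Zv j i \<in> php_vars m"
  unfolding php_vars_def by blast+

lemma csp_instance_php_system: "csp_instance (lin3_vocabulary G) (php_system G g m)"
  unfolding csp_instance_def is_struct_def
proof (intro conjI ballI)
  have "step_eqs m \<union> start_eqs m \<union> end_eqs m \<subseteq> tuples 3 (php_vars m)"
    by (auto simp: step_eqs_def start_eqs_def end_eqs_def tuples_def intro!: php_varsI)
  then show "interp (php_system G g m) R \<subseteq> tuples (arity (lin3_vocabulary G) R) (universe (php_system G g m))" for R
    by (auto simp: php_system_def lin3_vocabulary_def)
qed (simp add: php_system_def finite_php_vars)

lemma card_union_le3: "card (A \<union> B \<union> C) \<le> card A + card B + card C"
  using card_Un_le[of "A \<union> B" C] card_Un_le[of A B] by linarith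

text \<open>The constant 27 is a crude one shared with the count of equations; bounding lower-order
  terms by \<open>m^2\<close> gives 9 here and 10 there.\<close>

lemma num_variables_php_system:
  assumes "m \<ge> 1"
  shows "m\<^sup>2 \<le> num_variables (php_system G g m)" "num_variables (php_system G g m) \<le> 27 * m\<^sup>2"
proof -
  let ?A = "(\<lambda>(i, j). Xv i j) ` ({..m} \<times> {..<m})" and ?B = "(\<lambda>(i, j). Yv i j) ` ({..m} \<times> {..m})"
    and ?C = "(\<lambda>(j, i). Zv j i) ` ({..<m} \<times> {..Suc m})"
  have "card ?A = Suc m * m"
    by (subst card_image) (auto simp: inj_on_def Xv_def card_cartesian_product)
  moreover have "card ?A \<le> card (php_vars m)"
    unfolding php_vars_image by (rule card_mono) auto
  ultimately have "Suc m * m \<le> card (php_vars m)" by simp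
  then show "m\<^sup>2 \<le> num_variables (php_system G g m)"
    by (simp add: num_variables_def php_system_def power2_eq_square)
  have "card ?A \<le> Suc m * m" "card ?B \<le> Suc m * Suc m" "card ?C \<le> m * Suc (Suc m)"
    using card_image_le[of "{..m} \<times> {..<m}" "\<lambda>(i, j). Xv i j"] card_image_le[of "{..m} \<times> {..m}" "\<lambda>(i, j). Yv i j"]
      card_image_le[of "{..<m} \<times> {..Suc m}" "\<lambda>(j, i). Zv j i"]
    by (auto simp: card_cartesian_product)
  then have "card (php_vars m) \<le> Suc m * m + Suc m * Suc m + m * Suc (Suc m)"
    unfolding php_vars_image using card_union_le3[of ?A ?B ?C] by linarith
  also have "\<dots> = 3 * (m * m) + 5 * m + 1" by simp
  also have "\<dots> \<le> 27 * (m * m)"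
    using assms mult_le_mono2[OF assms, of m] mult_le_mono[OF assms assms] by linarith
  finally show "num_variables (php_system G g m) \<le> 27 * m\<^sup>2"
    by (simp add: num_variables_def php_system_def power2_eq_square)
qed

lemma (in group) lin_rel_symbols:
  assumes "g \<in> carrier G"
  shows "lin_rel G z1 z2 z3 g \<in> symbols (lin3_vocabulary G)"
  using assms by (auto simp: lin3_vocabulary_def)

lemma (in group) num_constraints_php_system:
  assumes "m \<ge> 1" "g \<in> carrier G"
  shows "m\<^sup>2 \<le> num_constraints (lin3_vocabulary G) (php_system G g m)"
    "num_constraints (lin3_vocabulary G) (php_system G g m) \<le> 27 * m\<^sup>2"
proof -
  let ?S = "lin_rel G 1 (-1) (-1) \<one>" and ?O = "lin_rel G 1 0 0 \<one>" and ?I = "lin_rel G 1 0 0 g"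
  have eq: "{(R, as). R \<in> symbols (lin3_vocabulary G) \<and> as \<in> interp (php_system G g m) R}
      = {?S} \<times> step_eqs m \<union> {?O} \<times> start_eqs m \<union> {?I} \<times> end_eqs m"
    using lin_rel_symbols assms(2) by (auto simp: php_system_def)
  have fin: "finite (step_eqs m)" "finite (start_eqs m)" "finite (end_eqs m)"
    by (simp_all add: step_eqs_image start_eqs_image end_eqs_image)
  let ?A = "(\<lambda>(i, j). [Yv i (Suc j), Yv i j, Xv i j]) ` ({..m} \<times> {..<m})"
  have "card ?A = Suc m * m"
    by (subst card_image) (auto simp: inj_on_def Xv_def card_cartesian_product)
  moreover have "card ?A \<le> card (step_eqs m)"
    unfolding step_eqs_image by (rule card_mono) auto
  moreover have "card ({?S} \<times> step_eqs m) \<le> num_constraints (lin3_vocabulary G) (php_system G g m)"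
    unfolding num_constraints_def eq using fin by (intro card_mono) auto
  ultimately have "Suc m * m \<le> num_constraints (lin3_vocabulary G) (php_system G g m)"
    by (simp add: card_cartesian_product)
  then show "m\<^sup>2 \<le> num_constraints (lin3_vocabulary G) (php_system G g m)"
    by (simp add: power2_eq_square)
  have i: "card (f ` ({..m} \<times> {..<m})) \<le> Suc m * m" for f :: "_ \<Rightarrow> nat list"
    using card_image_le[of "{..m} \<times> {..<m}" f] by (simp add: card_cartesian_product)
  have j: "card (f ` {..m}) \<le> Suc m" "card (f ` {..<m}) \<le> m" for f :: "_ \<Rightarrow> nat list"
    using card_image_le[of "{..m}" f] card_image_le[of "{..<m}" f] by simp_all
  have "card (step_eqs m) \<le> Suc m * m + Suc m * m"
    unfolding step_eqs_image by (rule order_trans[OF card_Un_le add_mono[OF i i]])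
  moreover have "card (start_eqs m) \<le> Suc m + m" "card (end_eqs m) \<le> Suc m + m"
    unfolding start_eqs_image end_eqs_image by (rule order_trans[OF card_Un_le add_mono[OF j(1) j(2)]])+
  ultimately have "num_constraints (lin3_vocabulary G) (php_system G g m)
      \<le> (Suc m * m + Suc m * m) + (Suc m + m) + (Suc m + m)"
    unfolding num_constraints_def eq
    using card_union_le3[of "{?S} \<times> step_eqs m" "{?O} \<times> start_eqs m" "{?I} \<times> end_eqs m"]
    by (simp add: card_cartesian_product)
  also have "\<dots> = 2 * (m * m) + 6 * m + 2" by simp
  also have "\<dots> \<le> 27 * (m * m)"
    using assms(1) mult_le_mono2[OF assms(1), of m] mult_le_mono[OF assms(1) assms(1)] by linarith
  finally show "num_constraints (lin3_vocabulary G) (php_system G g m) \<le> 27 * m\<^sup>2"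
    by (simp add: power2_eq_square)
qed

section \<open>Products over rows and columns, and unsatisfiability\<close>

primrec (in monoid) prefix_prod :: "(nat \<Rightarrow> 'a) \<Rightarrow> nat \<Rightarrow> 'a" where
  "prefix_prod f 0 = \<one>"
| "prefix_prod f (Suc n) = prefix_prod f n \<otimes> f n"

context comm_group
begin

lemma prefix_prod_closed: "(\<And>i. i < n \<Longrightarrow> f i \<in> carrier G) \<Longrightarrow> prefix_prod f n \<in> carrier G"
  by (induction n) auto

lemma prefix_prod_cong: "(\<And>i. i < n \<Longrightarrow> f i = h i) \<Longrightarrow> prefix_prod f n = prefix_prod h n"
  by (induction n) auto

lemma prefix_prod_mult:
  assumes "\<And>i. i < n \<Longrightarrow> f i \<in> carrier G" "\<And>i. i < n \<Longrightarrow> h i \<in> carrier G"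
  shows "prefix_prod (\<lambda>i. f i \<otimes> h i) n = prefix_prod f n \<otimes> prefix_prod h n"
  using assms
proof (induction n)
  case (Suc n)
  then have "prefix_prod f n \<in> carrier G" "prefix_prod h n \<in> carrier G" "f n \<in> carrier G" "h n \<in> carrier G"
    by (auto intro: prefix_prod_closed)
  then show ?case using Suc by (simp add: m_ac)
qed simp

lemma prefix_prod_one: "prefix_prod (\<lambda>i. \<one>) n = \<one>"
  by (induction n) auto

lemma prefix_prod_swap:
  assumes "\<And>i j. i < n \<Longrightarrow> j < m \<Longrightarrow> f i j \<in> carrier G"
  shows "prefix_prod (\<lambda>i. prefix_prod (f i) m) n = prefix_prod (\<lambda>j. prefix_prod (\<lambda>i. f i j) n) m"
  using assms
proof (induction n)
  case 0
  then show ?case by (simp add: prefix_prod_one)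
next
  case (Suc n)
  have "prefix_prod (\<lambda>j. prefix_prod (\<lambda>i. f i j) n \<otimes> f n j) m
      = prefix_prod (\<lambda>j. prefix_prod (\<lambda>i. f i j) n) m \<otimes> prefix_prod (f n) m"
    using Suc.prems by (intro prefix_prod_mult) (auto intro!: prefix_prod_closed)
  then show ?case using Suc by simp
qed

lemma lin_rel_step:
  "[a, b, c] \<in> lin_rel G 1 (-1) (-1) \<one> \<longleftrightarrow> a \<in> carrier G \<and> b \<in> carrier G \<and> c \<in> carrier G \<and> a = b \<otimes> c"
proof -
  have "a \<otimes> inv b \<otimes> inv c = \<one> \<longleftrightarrow> a = b \<otimes> c" if "a \<in> carrier G" "b \<in> carrier G" "c \<in> carrier G"
  proof -
    have "a \<otimes> inv b \<otimes> inv c = a \<otimes> inv (b \<otimes> c)"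
      using that by (simp add: inv_mult m_assoc)
    moreover have "\<one> = a \<otimes> inv (b \<otimes> c) \<longleftrightarrow> a = \<one> \<otimes> (b \<otimes> c)"
      by (rule inv_solve_right) (use that in auto)
    moreover have "\<one> \<otimes> (b \<otimes> c) = b \<otimes> c" using that by simp
    ultimately show ?thesis by metis
  qed
  then show ?thesis by (auto simp: lin_rel_def int_pow_neg)
qed

lemma lin_rel_const: "[a, a, a] \<in> lin_rel G 1 0 0 c \<longleftrightarrow> a \<in> carrier G \<and> a = c"
  by (auto simp: lin_rel_def)

theorem unsatisfiable_php_system:
  assumes g: "g \<in> carrier G" "g \<noteq> \<one>"
  shows "unsatisfiable (lin3_vocabulary G) (php_system G g m) (lin3_template G)"
  unfolding unsatisfiable_def
proof
  assume "\<exists>h. homomorphism (lin3_vocabulary G) (php_system G g m) (lin3_template G) h"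
  then obtain h where h: "\<And>R as. R \<in> symbols (lin3_vocabulary G) \<Longrightarrow> as \<in> interp (php_system G g m) R \<Longrightarrow> map h as \<in> R"
    unfolding homomorphism_def lin3_template_def by force
  have S: "map h as \<in> lin_rel G 1 (-1) (-1) \<one>" if "as \<in> step_eqs m" for as
    by (rule h[OF lin_rel_symbols]) (use that in \<open>auto simp: php_system_def\<close>)
  have O: "map h as \<in> lin_rel G 1 0 0 \<one>" if "as \<in> start_eqs m" for as
    by (rule h[OF lin_rel_symbols]) (use that in \<open>auto simp: php_system_def\<close>)
  have I: "map h as \<in> lin_rel G 1 0 0 g" if "as \<in> end_eqs m" for as
    by (rule h[OF lin_rel_symbols]) (use that g in \<open>auto simp: php_system_def\<close>)
  let ?x = "\<lambda>i j. h (Xv i j)"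
  have y: "h (Yv i (Suc j)) = h (Yv i j) \<otimes> ?x i j \<and> ?x i j \<in> carrier G" if "i \<le> m" "j < m" for i j
  proof -
    have "[Yv i (Suc j), Yv i j, Xv i j] \<in> step_eqs m" using that by (auto simp: step_eqs_def)
    from S[OF this] show ?thesis by (simp add: lin_rel_step)
  qed
  have z: "h (Zv j (Suc i)) = h (Zv j i) \<otimes> ?x i j" if "i \<le> m" "j < m" for i j
  proof -
    have "[Zv j (Suc i), Zv j i, Xv i j] \<in> step_eqs m" using that by (auto simp: step_eqs_def)
    from S[OF this] show ?thesis by (simp add: lin_rel_step)
  qed
  have y0: "h (Yv i 0) = \<one>" "h (Yv i m) = g" if "i \<le> m" for i
  proof -
    have "[Yv i 0, Yv i 0, Yv i 0] \<in> start_eqs m" "[Yv i m, Yv i m, Yv i m] \<in> end_eqs m"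
      using that by (auto simp: start_eqs_def end_eqs_def)
    with O I show "h (Yv i 0) = \<one>" "h (Yv i m) = g" using lin_rel_const by fastforce+
  qed
  have z0: "h (Zv j 0) = \<one>" "h (Zv j (Suc m)) = g" if "j < m" for j
  proof -
    have "[Zv j 0, Zv j 0, Zv j 0] \<in> start_eqs m" "[Zv j (Suc m), Zv j (Suc m), Zv j (Suc m)] \<in> end_eqs m"
      using that by (auto simp: start_eqs_def end_eqs_def)
    with O I show "h (Zv j 0) = \<one>" "h (Zv j (Suc m)) = g" using lin_rel_const by fastforce+
  qed
  have "j \<le> m \<Longrightarrow> h (Yv i j) = prefix_prod (?x i) j" if "i \<le> m" for i j
    using that by (induction j) (auto simp: y0 y)
  then have row: "prefix_prod (?x i) m = g" if "i \<le> m" for i using y0(2)[OF that] that by simp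
  have "i \<le> Suc m \<Longrightarrow> h (Zv j i) = prefix_prod (\<lambda>i. ?x i j) i" if "j < m" for i j
    using that by (induction i) (auto simp: z0 z)
  then have col: "prefix_prod (\<lambda>i. ?x i j) (Suc m) = g" if "j < m" for j using z0(2)[OF that] that by simp
  have "prefix_prod (\<lambda>i. g) (Suc m) = prefix_prod (\<lambda>i. prefix_prod (?x i) m) (Suc m)"
    by (rule prefix_prod_cong) (simp add: row)
  also have "\<dots> = prefix_prod (\<lambda>j. prefix_prod (\<lambda>i. ?x i j) (Suc m)) m"
    by (rule prefix_prod_swap) (use y in auto)
  also have "\<dots> = prefix_prod (\<lambda>j. g) m"
    by (rule prefix_prod_cong) (rule col)
  finally have "prefix_prod (\<lambda>i. g) m \<otimes> g = prefix_prod (\<lambda>i. g) m" by simp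
  moreover have "prefix_prod (\<lambda>i. g) m \<in> carrier G" using g by (intro prefix_prod_closed)
  ultimately show False using g l_cancel_one by blast
qed

end

section \<open>Local satisfaction of the pigeonhole system\<close>

definition pigeons :: "nat \<Rightarrow> (nat + nat) set" where "pigeons m = Inl ` {..m}"
definition holes :: "nat \<Rightarrow> (nat + nat) set" where "holes m = Inr ` {..<m}"

text \<open>Formulas of a refutation may mention variables outside the instance; these get the dummy vertex
  \<open>Inl 0\<close>.\<close>

definition php_vertex :: "nat \<Rightarrow> nat \<Rightarrow> nat + nat" where
  "php_vertex m v = (case prod_decode v of (t, p) \<Rightarrow> case prod_decode p of (i, j) \<Rightarrow>
     if t \<le> 1 \<and> i \<le> m then Inl i else if t = 2 \<and> i < m then Inr i else Inl 0)"

text \<open>A row has the factor \<open>g\<close> exactly once, at the partner of its pigeon, so its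
  prefix product jumps there from \<open>\<one>\<close> to \<open>g\<close>; likewise for columns.
  Hence one edge fixes all values at its two vertices.\<close>

definition php_value :: "('g, 'm) monoid_scheme \<Rightarrow> 'g \<Rightarrow> nat \<Rightarrow> (nat + nat) set \<Rightarrow> 'g" where
  "php_value G g v e = (case prod_decode v of (t, p) \<Rightarrow> case prod_decode p of (i, j) \<Rightarrow>
     if t = 0 \<and> Inr j \<in> e \<or> t = 1 \<and> (\<exists>q<j. Inr q \<in> e) \<or> t = 2 \<and> (\<exists>q<j. Inl q \<in> e)
     then g else \<one>\<^bsub>G\<^esub>)"

lemma php_vertex_simps:
  "i \<le> m \<Longrightarrow> php_vertex m (Xv i j) = Inl i" "i \<le> m \<Longrightarrow> php_vertex m (Yv i j) = Inl i"
  "j < m \<Longrightarrow> php_vertex m (Zv j i) = Inr j"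
  by (auto simp: php_vertex_def var_defs)

lemma php_value_simps:
  "php_value G g (Xv i j) e = (if Inr j \<in> e then g else \<one>\<^bsub>G\<^esub>)"
  "php_value G g (Yv i j) e = (if \<exists>q<j. Inr q \<in> e then g else \<one>\<^bsub>G\<^esub>)"
  "php_value G g (Zv j i) e = (if \<exists>q<i. Inl q \<in> e then g else \<one>\<^bsub>G\<^esub>)"
  by (auto simp: php_value_def var_defs)

lemma php_valued_bipartite: "valued_bipartite (pigeons m) (holes m) (php_vertex m)"
proof
  show "card (pigeons m) = Suc (card (holes m))"
    by (simp add: pigeons_def holes_def card_image)
  show "php_vertex m v \<in> pigeons m \<union> holes m" for v
    by (auto simp: php_vertex_def pigeons_def holes_def split: prod.splits)
qed (auto simp: pigeons_def holes_def)

lemma card_holes: "card (holes m) = m"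
  by (simp add: holes_def card_image)

text \<open>The unknowns of a row equation belong to one pigeon and read the same edge. In a column
  equation, \<open>Xv i j\<close> reads the edge at pigeon \<open>i\<close> and the prefix products
  read the edge at hole \<open>j\<close>; both edges lie in one matching, so they agree on whether
  \<open>i\<close> and \<open>j\<close> are partners.\<close>

lemma (in comm_group) php_system_locally_consistent:
  assumes g: "g \<in> carrier G"
    and M: "bipartite.matching (pigeons m) (holes m) M"
    and as: "as \<in> interp (php_system G g m) R"
    and f: "\<And>v. v \<in> set as \<Longrightarrow> f v \<in> M \<and> php_vertex m v \<in> f v"
  shows "map (\<lambda>v. php_value G g v (f v)) as \<in> R"
proof -
  interpret P: valued_bipartite "pigeons m" "holes m" "php_vertex m" "php_value G g"
    by (rule php_valued_bipartite)
  let ?u = "\<lambda>v. php_value G g v (f v)"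
  have edge: "\<exists>p q. p \<le> m \<and> q < m \<and> e = {Inl p, Inr q}" if "e \<in> M" for e
  proof -
    have "e \<in> P.edges" using M that by (auto simp: P.matching_def)
    then show ?thesis unfolding P.edges_def by (auto simp: pigeons_def holes_def)
  qed
  have unique: "f v = f w" if "v \<in> set as" "w \<in> set as" "x \<in> f v" "x \<in> f w" for v w x
    using P.matching_unique[OF M] f that by blast
  consider (pigeon) i j where "R = lin_rel G 1 (-1) (-1) \<one>" "as = [Yv i (Suc j), Yv i j, Xv i j]" "i \<le> m" "j < m"
    | (hole) i j where "R = lin_rel G 1 (-1) (-1) \<one>" "as = [Zv j (Suc i), Zv j i, Xv i j]" "i \<le> m" "j < m"
    | (start) "R = lin_rel G 1 0 0 \<one>" "as \<in> start_eqs m"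
    | (finish) "R = lin_rel G 1 0 0 g" "as \<in> end_eqs m"
    using as by (auto simp: php_system_def step_eqs_def)
  then show ?thesis
  proof cases
    case pigeon
    have in_f: "Inl i \<in> f v" "f v \<in> M" if "v \<in> set as" for v
      using f[OF that] that pigeon by (auto simp: php_vertex_simps)
    have same: "f v = f (Xv i j)" if "v \<in> set as" for v
      using unique[OF that _ in_f(1)[OF that] in_f(1)] pigeon by simp
    obtain q where q: "f (Xv i j) = {Inl i, Inr q}"
      using edge[OF in_f(2), of "Xv i j"] in_f(1)[of "Xv i j"] pigeon by auto
    have "f (Yv i (Suc j)) = {Inl i, Inr q}" "f (Yv i j) = {Inl i, Inr q}"
      using same q pigeon by auto
    then show ?thesis unfolding pigeon using q g by (auto simp: lin_rel_step php_value_simps less_Suc_eq)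
  next
    case hole
    have vx: "Inl i \<in> f (Xv i j)" "f (Xv i j) \<in> M" using f[of "Xv i j"] hole by (auto simp: php_vertex_simps)
    have vz: "Inr j \<in> f v" "f v \<in> M" if "v = Zv j (Suc i) \<or> v = Zv j i" for v
      using f[of v] hole that by (auto simp: php_vertex_simps)
    have z: "f (Zv j (Suc i)) = f (Zv j i)"
      using unique[of "Zv j (Suc i)" "Zv j i" "Inr j"] vz hole by auto
    obtain p where p: "f (Zv j i) = {Inl p, Inr j}" using edge[OF vz(2), of "Zv j i"] vz(1)[of "Zv j i"] by auto
    obtain q where q: "f (Xv i j) = {Inl i, Inr q}" using edge[OF vx(2)] vx(1) by auto
    have "p = i \<longleftrightarrow> q = j"
    proof
      assume "p = i"
      then have "f (Zv j i) = f (Xv i j)" using unique[of "Zv j i" "Xv i j" "Inl i"] p q hole by simp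
      then show "q = j" using p q by (auto simp: doubleton_eq_iff)
    next
      assume "q = j"
      then have "f (Zv j i) = f (Xv i j)" using unique[of "Zv j i" "Xv i j" "Inr j"] p q hole by simp
      then show "p = i" using p q by (auto simp: doubleton_eq_iff)
    qed
    then show ?thesis unfolding hole using z p q g by (auto simp: lin_rel_step php_value_simps less_Suc_eq)
  next
    case start
    then obtain v where v: "as = [v, v, v]" "v \<in> {Yv i 0 | i. i \<le> m} \<union> {Zv j 0 | j. j < m}"
      by (auto simp: start_eqs_def)
    then have "?u v = \<one>" by (auto simp: php_value_simps)
    then show ?thesis unfolding start v by (simp add: lin_rel_const)
  next
    case finish
    then obtain v where v: "as = [v, v, v]" "v \<in> {Yv i m | i. i \<le> m} \<union> {Zv j (Suc m) | j. j < m}"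
      by (auto simp: end_eqs_def)
    \<comment> \<open>A prefix of full length, \<open>m\<close> for rows and \<open>Suc m\<close>
      for columns, contains every possible partner.\<close>
    obtain p q where "p \<le> m" "q < m" "f v = {Inl p, Inr q}" using edge f v by (metis list.set_intros(1))
    then have "?u v = g" using v(2) by (auto simp: php_value_simps)
    then show ?thesis unfolding finish v using g by (simp add: lin_rel_const)
  qed
qed

text \<open>A clause about one unknown is settled by the edge at its vertex. An equation clause
  excludes one violating triple; the triple read off the matching satisfies the equation, so they
  differ at some position, and the literal there holds.\<close>

lemma (in comm_group) locally_satisfied_php_system:
  assumes g: "g \<in> carrier G"
  shows "valued_bipartite.locally_satisfied (pigeons m) (holes m) (php_vertex m) (php_value G g)
    (CNF (lin3_vocabulary G) (php_system G g m) (lin3_template G))"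
proof -
  interpret P: valued_bipartite "pigeons m" "holes m" "php_vertex m" "php_value G g"
    by (rule php_valued_bipartite)
  have val: "php_value G g v e \<in> carrier G" for v e
    using g by (auto simp: php_value_def split: prod.splits)
  have single: "\<exists>W\<subseteq>pigeons m \<union> holes m. card W \<le> 3 \<and>
      (\<forall>M. P.matching M \<and> W \<subseteq> \<Union>M \<longrightarrow> (\<exists>l\<in>C. M \<in> P.lit_holds l))"
    if "\<And>M e. P.matching M \<Longrightarrow> e \<in> M \<Longrightarrow> php_vertex m a \<in> e \<Longrightarrow> \<exists>l\<in>C. M \<in> P.lit_holds l" for C a
  proof (intro exI[of _ "{php_vertex m a}"] conjI allI impI)
    fix M assume "P.matching M \<and> {php_vertex m a} \<subseteq> \<Union>M"
    then show "\<exists>l\<in>C. M \<in> P.lit_holds l" using that by blast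
  qed (use P.vertex in auto)
  have clause: "\<exists>W\<subseteq>pigeons m \<union> holes m. card W \<le> 3 \<and>
      (\<forall>M. P.matching M \<and> W \<subseteq> \<Union>M \<longrightarrow> (\<exists>l\<in>C. M \<in> P.lit_holds l))"
    if "C \<in> CNF (lin3_vocabulary G) (php_system G g m) (lin3_template G)" for C
  proof -
    consider (some_value) a where "C = {Pos (a, b) | b. b \<in> carrier G}"
      | (one_value) a b0 b1 where "C = {Neg (a, b0), Neg (a, b1)}" "b0 \<noteq> b1"
      | (equation) R as bs where "C = {Neg (as ! i, bs ! i) | i. i < 3}" "as \<in> interp (php_system G g m) R"
        "length as = 3" "bs \<in> tuples 3 (carrier G) - R"
    proof -
      have len: "length as = 3" if "as \<in> interp (php_system G g m) R" for R as
        using that by (auto simp: php_system_def step_eqs_def start_eqs_def end_eqs_def)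
      show ?thesis
        using that \<open>C \<in> _\<close> len unfolding CNF_def lin3_template_def
        by (auto simp: lin3_vocabulary_def)
    qed
    then show ?thesis
    proof cases
      case some_value
      show ?thesis
      proof (rule single[of a])
        fix M e assume "P.matching M" "e \<in> M" "php_vertex m a \<in> e"
        then have "M \<in> P.lit_holds (Pos (a, php_value G g a e))"
          by (auto simp: P.lit_holds_def P.atom_holds_def)
        then show "\<exists>l\<in>C. M \<in> P.lit_holds l" using some_value val by blast
      qed
    next
      case one_value
      show ?thesis
      proof (rule single[of a])
        fix M e assume "P.matching M" "e \<in> M" "php_vertex m a \<in> e"
        then have neg: "M \<in> P.lit_holds (Neg (a, b))" if "php_value G g a e \<noteq> b" for b
          using that by (auto simp: P.lit_holds_def P.atom_holds_def)
        show "\<exists>l\<in>C. M \<in> P.lit_holds l"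
          using neg[of b0] neg[of b1] one_value by (cases "php_value G g a e = b0") auto
      qed
    next
      case equation
      let ?W = "php_vertex m ` set as"
      have W1: "card ?W \<le> 3"
        using card_image_le[of "set as" "php_vertex m"] card_length[of as] equation(3) by simp
      have W2: "?W \<subseteq> pigeons m \<union> holes m" using P.vertex by auto
      have W3: "\<exists>l\<in>C. M \<in> P.lit_holds l" if M: "P.matching M" "?W \<subseteq> \<Union>M" for M
      proof (rule ccontr)
        assume no: "\<not> (\<exists>l\<in>C. M \<in> P.lit_holds l)"
        have "\<forall>v\<in>set as. \<exists>e. e \<in> M \<and> php_vertex m v \<in> e" using M(2) by blast
        then obtain f where f: "\<And>v. v \<in> set as \<Longrightarrow> f v \<in> M \<and> php_vertex m v \<in> f v" by metis
        have "map (\<lambda>v. php_value G g v (f v)) as = bs"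
        proof (rule nth_equalityI)
          show "length (map (\<lambda>v. php_value G g v (f v)) as) = length bs"
            using equation by (simp add: tuples_def)
          fix i assume "i < length (map (\<lambda>v. php_value G g v (f v)) as)"
          then have i: "i < 3" "i < length as" using equation by auto
          then have "M \<notin> P.lit_holds (Neg (as ! i, bs ! i))" using no equation(1) by blast
          then show "map (\<lambda>v. php_value G g v (f v)) as ! i = bs ! i"
            using f[of "as ! i"] i M(1) by (auto simp: P.lit_holds_def P.atom_holds_def)
        qed
        then show False
          using php_system_locally_consistent[OF g M(1) equation(2) f] equation(4) by simp
      qed
      show ?thesis
      proof (intro exI[of _ ?W] conjI allI impI)
        fix M assume "P.matching M \<and> ?W \<subseteq> \<Union>M"
        then show "\<exists>l\<in>C. M \<in> P.lit_holds l" using W3[of M] by simp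
      qed (fact W2, fact W1)
    qed
  qed
  show ?thesis unfolding P.locally_satisfied_def by (rule ballI, rule clause)
qed

section \<open>Growth of the parameters and the final exponent\<close>

lemma holes_needed_le_power:
  assumes "k \<ge> 1"
  shows "holes_needed k n \<le> (10 * k) ^ 8 ^ n"
proof (induction n)
  case (Suc n)
  let ?h = "holes_needed k n"
  have h: "10 * k \<le> ?h" by (rule holes_needed_ge)
  then have h10: "10 \<le> ?h" using assms by linarith
  \<comment> \<open>With \<open>h\<close> for \<open>?h\<close>, the round adds at most
    \<open>4 h (2 h)^4 = 64 h^5\<close>, and \<open>65 h^5 \<le> h^8\<close> since
    \<open>h \<ge> 10\<close>; this is the exponent 8 per round.\<close>
  have "32 * k \<le> 4 * ?h" using h by linarith
  moreover have "(?h + 1) ^ 4 \<le> (2 * ?h) ^ 4" using h10 by (intro power_mono) auto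
  ultimately have "32 * k * (?h + 1) ^ 4 \<le> (4 * ?h) * (2 * ?h) ^ 4" by (rule mult_le_mono)
  also have "\<dots> = 64 * ?h ^ 5" by (simp add: power_mult_distrib flip: power_Suc)
  finally have "holes_needed k (Suc n) \<le> ?h + 64 * ?h ^ 5" by simp
  also have "\<dots> \<le> 65 * ?h ^ 5" using self_le_power[of ?h 5] h10 by simp
  also have "\<dots> \<le> ?h ^ 3 * ?h ^ 5"
  proof (rule mult_le_mono1)
    have "(10 :: nat) ^ 3 \<le> ?h ^ 3" using h10 by (rule power_mono) simp
    then show "65 \<le> ?h ^ 3" by simp
  qed
  also have "\<dots> = ?h ^ 8" by (simp flip: power_add)
  also have "\<dots> \<le> ((10 * k) ^ 8 ^ n) ^ 8" by (rule power_mono[OF Suc.IH]) simp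
  also have "\<dots> = (10 * k) ^ 8 ^ Suc n" by (simp only: power_Suc2 power_mult)
  finally show ?case .
qed simp

lemma eventually_root_le: "c > 0 \<Longrightarrow> \<forall>\<^sub>F n :: nat in sequentially. c * real n powr (1 / 4) \<le> sqrt (real n) - 1"
  by real_asymp

theorem theorem6p3:
  fixes d :: int and G :: "('g, 'm) monoid_scheme"
  assumes "comm_group G" and "finite (carrier G)" and "carrier G \<noteq> {\<one>\<^bsub>G\<^esub>}"
  shows "\<exists>\<delta>::real. \<delta> > 0 \<and> (\<exists>\<AA> :: nat \<Rightarrow> ('g list set, nat) rel_struct.
      (\<forall>n\<ge>1. csp_instance (lin3_vocabulary G) (\<AA> n) \<and>
              unsatisfiable (lin3_vocabulary G) (\<AA> n) (lin3_template G)) \<and>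
      (\<lambda>n. real (num_variables (\<AA> n))) \<in> \<Theta>(\<lambda>n. real n) \<and>
      (\<lambda>n. real (num_constraints (lin3_vocabulary G) (\<AA> n))) \<in> \<Theta>(\<lambda>n. real n) \<and>
      (\<forall>\<^sub>F n in sequentially. \<forall>\<pi>.
         frege_refutation (CNF (lin3_vocabulary G) (\<AA> n) (lin3_template G)) \<pi> \<and> has_depth d \<pi> \<longrightarrow>
         real (refutation_size \<pi>) \<ge> 2 powr (real n powr \<delta>)))"
proof -
  interpret comm_group G by fact
  obtain g where g: "g \<in> carrier G" "g \<noteq> \<one>\<^bsub>G\<^esub>" using assms(3) one_closed by blast
  define T where "T = Suc (nat d)"
  define K :: nat where "K = 8 ^ T"
  \<comment> \<open>Since \<open>K * \<delta> = 1 / 4\<close>, a \<open>k\<close> of about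
    \<open>n powr \<delta>\<close> requires order \<open>n powr (1 / 4)\<close> holes, fewer than
    the roughly \<open>sqrt n\<close> available.\<close>
  define \<delta> :: real where "\<delta> = 1 / (4 * real K)"
  \<comment> \<open>With \<open>m\<close> holes the system has order \<open>m^2\<close> unknowns and
    equations.\<close>
  define m where "m n = nat \<lfloor>sqrt (real n)\<rfloor>" for n :: nat
  have K: "K > 0" by (simp add: K_def)
  have m: "1 \<le> m n" "(m n)\<^sup>2 \<le> n" "n \<le> 4 * (m n)\<^sup>2" "sqrt (real n) < real (m n) + 1" if "n \<ge> 1" for n
  proof -
    have "1 \<le> sqrt (real n)" using that by simp
    then show 1: "1 \<le> m n" by (simp add: m_def le_nat_iff le_floor_iff)
    have le: "real (m n) \<le> sqrt (real n)" by (simp add: m_def)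
    then have "(real (m n))\<^sup>2 \<le> (sqrt (real n))\<^sup>2" by (intro power_mono) auto
    then show "(m n)\<^sup>2 \<le> n" by (simp flip: of_nat_power)
    have "real_of_int \<lfloor>sqrt (real n)\<rfloor> = real (m n)" by (simp add: m_def)
    then show lt: "sqrt (real n) < real (m n) + 1" by linarith
    then have "sqrt (real n) \<le> 2 * real (m n)" using 1 by linarith
    then have "(sqrt (real n))\<^sup>2 \<le> (2 * real (m n))\<^sup>2" by (intro power_mono) auto
    then have "real n \<le> real (4 * (m n)\<^sup>2)" by (simp add: power_mult_distrib)
    then show "n \<le> 4 * (m n)\<^sup>2" by (simp only: of_nat_le_iff)
  qed
  have linear: "(\<lambda>n. real (f n)) \<in> \<Theta>(\<lambda>n. real n)"
    if f: "\<And>n. n \<ge> 1 \<Longrightarrow> (m n)\<^sup>2 \<le> f n" "\<And>n. n \<ge> 1 \<Longrightarrow> f n \<le> 27 * (m n)\<^sup>2" for f :: "nat \<Rightarrow> nat"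
  proof (rule bigthetaI'[of "1 / 4" 27])
    show "\<forall>\<^sub>F n in sequentially. 1 / 4 * norm (real n) \<le> norm (real (f n)) \<and> norm (real (f n)) \<le> 27 * norm (real n)"
      using eventually_ge_at_top[of 1]
    proof eventually_elim
      case (elim n)
      have "n \<le> 4 * f n" "f n \<le> 27 * n" using m(2,3)[OF elim] f[OF elim] by linarith+
      then show ?case by simp
    qed
  qed simp_all
  have root: "\<forall>\<^sub>F n in sequentially. 20 ^ K * real n powr (1 / 4) \<le> sqrt (real n) - 1"
    by (rule eventually_root_le) simp
  have "\<forall>\<^sub>F n in sequentially. \<forall>\<pi>.
      frege_refutation (CNF (lin3_vocabulary G) (php_system G g (m n)) (lin3_template G)) \<pi> \<and> has_depth d \<pi> \<longrightarrow>
      real (refutation_size \<pi>) \<ge> 2 powr (real n powr \<delta>)"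
    using eventually_ge_at_top[of 1] root
  proof eventually_elim
    case (elim n)
    define k where "k = nat \<lceil>real n powr \<delta>\<rceil>"
    have p1: "1 \<le> real n powr \<delta>" using elim(1) by (intro ge_one_powr_ge_zero) (auto simp: \<delta>_def)
    have kge: "real n powr \<delta> \<le> real k" and kle: "real k \<le> real n powr \<delta> + 1"
      unfolding k_def using p1 by linarith+
    have k1: "k \<ge> 1" using kge p1 by linarith
    have "real (holes_needed k T) \<le> real ((10 * k) ^ K)"
      unfolding K_def by (rule of_nat_mono[OF holes_needed_le_power[OF k1]])
    also have "\<dots> = (10 * real k) ^ K" by simp
    \<comment> \<open>Rounding up costs a factor 2:
      \<open>k \<le> n powr \<delta> + 1 \<le> 2 * n powr \<delta>\<close>.\<close>
    also have "\<dots> \<le> (20 * real n powr \<delta>) ^ K" using kle p1 by (intro power_mono) auto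
    also have "\<dots> = 20 ^ K * real n powr (real K * \<delta>)"
      using elim(1) by (simp add: power_mult_distrib powr_power)
    also have "real K * \<delta> = 1 / 4" using K by (simp add: \<delta>_def)
    also have "20 ^ K * real n powr (1 / 4) \<le> sqrt (real n) - 1" using elim(2) by simp
    also have "\<dots> < real (m n)" using m(4)[OF elim(1)] by simp
    finally have holes_needed: "holes_needed k T \<le> m n" by simp
    show ?case
    proof (intro allI impI, elim conjE)
      fix \<pi> assume \<pi>: "frege_refutation (CNF (lin3_vocabulary G) (php_system G g (m n)) (lin3_template G)) \<pi>"
        "has_depth d \<pi>"
      interpret P: valued_bipartite "pigeons (m n)" "holes (m n)" "php_vertex (m n)" "php_value G g"
        by (rule php_valued_bipartite)
      have "2 ^ k < refutation_size \<pi>"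
        using P.refutation_size_lower_bound[OF locally_satisfied_php_system[OF g(1)] \<pi> k1] holes_needed
        by (simp add: card_holes T_def)
      then have "real (2 ^ k) \<le> real (refutation_size \<pi>)" by (intro of_nat_mono) simp
      moreover have "2 powr (real n powr \<delta>) \<le> 2 powr real k" using kge by simp
      moreover have "2 powr real k = real (2 ^ k)" by (simp add: powr_realpow)
      ultimately show "2 powr (real n powr \<delta>) \<le> real (refutation_size \<pi>)" by linarith
    qed
  qed
  moreover have "(\<lambda>n. real (num_variables (php_system G g (m n)))) \<in> \<Theta>(\<lambda>n. real n)"
    by (rule linear; rule num_variables_php_system; erule m(1))
  moreover have "(\<lambda>n. real (num_constraints (lin3_vocabulary G) (php_system G g (m n)))) \<in> \<Theta>(\<lambda>n. real n)"
    by (rule linear; rule num_constraints_php_system; (erule m(1) | rule g(1)))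
  moreover have "\<delta> > 0" using K by (simp add: \<delta>_def)
  ultimately show ?thesis
    using csp_instance_php_system unsatisfiable_php_system[OF g]
    by (intro exI[of _ \<delta>] conjI exI[of _ "\<lambda>n. php_system G g (m n)"]) auto
qed

end
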